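(* Consider the model $y=G(u)+\frac1{\sqrt n}\eta$ with priors $\mu_n$ on $\mathcal H_1$, noise $\eta\sim\mathcal N(0,\zeta)$ and posteriors $\mu_n^y$ as described in the context, and let $u_0\in\mathcal H_1$. Let $\{\varphi_k\}_{k\ge1}$ be an orthonormal basis of $\mathcal H_1$ such that $S\varphi_j\in\mathcal H_2$ is defined for all $j$, where $S=(G^{-1})^T$, let $P^\varphi_k$ be the orthogonal projection onto $\mathrm{span}\{\varphi_1,\dots,\varphi_k\}$, and put $$g_k=\max\{\|\zeta^{1/2}Sh\|_2^2:\ h\in\mathrm{span}\{\varphi_1,\dots,\varphi_k\},\ \|h\|_1\le1\}.$$ Assume there are positive real sequences $\epsilon_n,\xi_n$, positive integers $k_n$, and constants $C,C_1,C_2,R>0$ such that: (1) $\epsilon_n\to0$, $n\epsilon_n^2\to\infty$ and $\mu_n\{u:\|G(u)-G(u_0)\|_\zeta\le\epsilon_n\}\ge e^{-Cn\epsilon_n^2}$; (2) $k_n<Rn\epsilon_n^2$, $\max\{\xi_n,k_n^{-1}\}\to0$, and $\mu_n\{u:\|P^\varphi_{k_n}u-u\|_1>C_2\xi_n\}\le e^{-(C+4)n\epsilon_n^2}$; (3) $\sqrt{g_{k_n}}\le C_1\,\xi_n/\epsilon_n$; (4) $\|P^\varphi_{k_n}u_0-u_0\|_1=O(\xi_n)$. Then there is $M>0$ such that $$\mu_n^y(u:\|u-u_0\|_1>M\xi_n)\to0\quad\text{in }\mathbb Q_{u_0,n}\text{-probability as }n\to\infty.$$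
   Context: $\mathcal H_1,\mathcal H_2$ are infinite-dimensional separable Hilbert spaces with norms $\|\cdot\|_1,\|\cdot\|_2$; $G:\mathcal H_1\to\mathcal H_2$ is a bounded injective linear operator. $\eta$ is a centered Gaussian noise on $\mathcal H_2$ with covariance operator $\zeta$ (bounded, self-adjoint, positive definite; if $\zeta$ is not trace class, e.g. white noise $\zeta=I$, $\eta$ lives on a larger space $\widehat{\mathcal H}_2=\prod_i\mathbb R b_i$, $\{b_i\}$ an orthonormal basis of $\mathcal H_2$, and $\langle\eta,x\rangle_2$ are centered jointly Gaussian with covariance $\langle\zeta x,x'\rangle_2$). The Cameron–Martin inner product is $\langle x,x'\rangle_\zeta=\langle\zeta^{-1/2}x,\zeta^{-1/2}x'\rangle_2$ on $\mathcal H_\zeta=\zeta^{1/2}\mathcal H_2$, with norm $\|\cdot\|_\zeta$. Standing assumption: $G(\mathcal H_1)\subset\mathcal H_\zeta$. For each $n$, $\mu_n$ is a Borel probability measure on $\mathcal H_1$ (prior, law of $u$), $u$ independent of $\eta$. $\mathbb Q_{v,n}$ is the law of $G(v)+\eta/\sqrt n$ for fixed $v\in\mathcal H_1$. The posterior is $\mu_n^y(B)=\frac{1}{Z_n^y}\int_B e^{-\Phi(y,u)}d\mu_n(u)$, $\Phi(y,u)=\frac n2\|G(u)\|_\zeta^2-n\langle y,G(u)\rangle_\zeta$, $Z_n^y=\int_{\mathcal H_1}e^{-\Phi(y,u)}d\mu_n(u)$, where $\langle y,\cdot\rangle_\zeta$ is the (a.s. defined) measurable linear functional. $S=(G^{-1})^T$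 is the adjoint of $G^{-1}:G(\mathcal H_1)\to\mathcal H_1$: $S\varphi=w$ means $w\in\overline{G(\mathcal H_1)}$ and $G^Tw=\varphi$, with $G^T$ the adjoint of $G$. *)

theory Defs
  imports "HOL-Probability.Probability" "HOL-Library.Landau_Symbols"
begin

text \<open>A separable real Hilbert space is a type of sort
  \<open>{real_inner, polish_space}\<close>: \<open>polish_space\<close> adds completeness and a countable base.\<close>

text \<open>Since the basis is indexed by all of \<open>nat\<close>, the existence of an orthonormal basis in this
  sense makes the space infinite-dimensional. Indices start at 0, so that the first \<open>k\<close>
  elements are \<open>e ` {..<k}\<close>.\<close>

definition orthonormal_basis :: "(nat \<Rightarrow> 'a::real_inner) \<Rightarrow> bool" where
  "orthonormal_basis e \<longleftrightarrow>
     (\<forall>i j. e i \<bullet> e j = (if i = j then 1 else 0)) \<and> closure (span (range e)) = UNIV"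

definition orth_proj :: "'a::real_inner set \<Rightarrow> 'a \<Rightarrow> 'a" where
  "orth_proj V u = (THE p. p \<in> V \<and> (\<forall>v\<in>V. (u - p) \<bullet> v = 0))"

definition self_adjoint :: "('a::real_inner \<Rightarrow> 'a) \<Rightarrow> bool" where
  "self_adjoint T \<longleftrightarrow> (\<forall>x y. T x \<bullet> y = x \<bullet> T y)"

definition op_sqrt :: "('a::real_inner \<Rightarrow> 'a) \<Rightarrow> 'a \<Rightarrow> 'a" where
  "op_sqrt T = (THE R. bounded_linear R \<and> self_adjoint R \<and> (\<forall>x. 0 \<le> R x \<bullet> x) \<and> R \<circ> R = T)"

definition cov_operator :: "('a::real_inner \<Rightarrow> 'a) \<Rightarrow> bool" where
  "cov_operator \<zeta> \<longleftrightarrow> bounded_linear \<zeta> \<and> self_adjoint \<zeta> \<and> (\<forall>x. x \<noteq> 0 \<longrightarrow> 0 < \<zeta> x \<bullet> x)"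

definition cm_space :: "('b::real_inner \<Rightarrow> 'b) \<Rightarrow> 'b set" where
  "cm_space \<zeta> = range (op_sqrt \<zeta>)"

definition cm_norm :: "('b::real_inner \<Rightarrow> 'b) \<Rightarrow> 'b \<Rightarrow> real" where
  "cm_norm \<zeta> x = norm (inv (op_sqrt \<zeta>) x)"

text \<open>The adjoint \<open>S\<close> of the (in general unbounded) inverse of \<open>G\<close>, and its domain.\<close>

definition inv_adjoint_dom :: "('a::real_inner \<Rightarrow> 'b::real_inner) \<Rightarrow> 'a set" where
  "inv_adjoint_dom G = {\<phi>. \<exists>w \<in> closure (range G). adjoint G w = \<phi>}"

definition inv_adjoint :: "('a::real_inner \<Rightarrow> 'b::real_inner) \<Rightarrow> 'a \<Rightarrow> 'b" where
  "inv_adjoint G \<phi> = (THE w. w \<in> closure (range G) \<and> adjoint G w = \<phi>)"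

text \<open>The supremum is over the continuous image of a compact set (the unit ball of a
  finite-dimensional subspace), hence is the maximum.\<close>

definition noise_gain ::
  "('b::real_inner \<Rightarrow> 'b) \<Rightarrow> ('a::real_inner \<Rightarrow> 'b) \<Rightarrow> (nat \<Rightarrow> 'a) \<Rightarrow> nat \<Rightarrow> real" where
  "noise_gain \<zeta> G \<phi> k =
     (SUP h \<in> {h \<in> span (\<phi> ` {..<k}). norm h \<le> 1}. (norm (op_sqrt \<zeta> (inv_adjoint G h)))\<^sup>2)"

text \<open>Noise and data live in the product \<open>\<Prod>\<^sub>i \<real> b\<^sub>i\<close> over an orthonormal basis \<open>b\<close> of the
  data space; an element is given by its coordinates, and \<open>x\<close> in the Hilbert space is
  identified with \<open>\<lambda>i. x \<bullet> b i\<close>.\<close>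

abbreviation data_space :: "(nat \<Rightarrow> real) measure" where
  "data_space \<equiv> (\<Pi>\<^sub>M i\<in>UNIV. borel)"

definition centered_normal :: "real \<Rightarrow> real measure" where
  "centered_normal v = (if v = 0 then return borel 0 else density lborel (normal_density 0 (sqrt v)))"

definition gaussian_noise ::
  "'o measure \<Rightarrow> ('b::real_inner \<Rightarrow> 'b) \<Rightarrow> (nat \<Rightarrow> 'b) \<Rightarrow> ('o \<Rightarrow> nat \<Rightarrow> real) \<Rightarrow> bool" where
  "gaussian_noise P \<zeta> b \<eta> \<longleftrightarrow> prob_space P \<and> \<eta> \<in> measurable P data_space \<and>
     (\<forall>J c. finite J \<longrightarrow>
        distr P borel (\<lambda>\<omega>. \<Sum>i\<in>J. c i * \<eta> \<omega> i) =
        centered_normal (\<Sum>i\<in>J. \<Sum>j\<in>J. c i * c j * (\<zeta> (b i) \<bullet> b j)))"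

definition data_law ::
  "'o measure \<Rightarrow> (nat \<Rightarrow> 'b::real_inner) \<Rightarrow> ('o \<Rightarrow> nat \<Rightarrow> real) \<Rightarrow> ('a \<Rightarrow> 'b) \<Rightarrow> nat \<Rightarrow> 'a
     \<Rightarrow> (nat \<Rightarrow> real) measure" where
  "data_law P b \<eta> G n v = distr P data_space (\<lambda>\<omega> i. G v \<bullet> b i + \<eta> \<omega> i / sqrt (real n))"

text \<open>The pairing of \<open>y\<close> with \<open>x\<close>, for \<open>x\<close> in the algebraic span of the basis, where it is a
  finite sum of coordinates.\<close>

definition coord_pairing ::
  "(nat \<Rightarrow> 'b::real_inner) \<Rightarrow> (nat \<Rightarrow> real) \<Rightarrow> 'b \<Rightarrow> real" where
  "coord_pairing b y x = (\<Sum>i | x \<bullet> b i \<noteq> 0. (x \<bullet> b i) * y i)"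

text \<open>\<open>L y h\<close> is a jointly measurable version of the measurable linear functional
  \<open>\<langle>y, h\<rangle>\<^sub>\<zeta>\<close> with respect to the noise law \<open>\<gamma>\<close>. For \<open>h = \<zeta> x\<close> the Cameron-Martin pairing of
  \<open>y\<close> and \<open>h\<close> is the pairing of \<open>y\<close> and \<open>x\<close>; for \<open>x\<close> in the span of the basis this
  is a finite sum of coordinates. Such \<open>h\<close> are dense in the Cameron-Martin space, and the
  functional extends to the whole space by continuity into \<open>L\<^sup>2(\<gamma>)\<close>. Each \<open>L \<cdot> h\<close> is
  thereby determined \<open>\<gamma>\<close>-almost surely.\<close>

definition cm_functional ::
  "('b::real_inner \<Rightarrow> 'b) \<Rightarrow> (nat \<Rightarrow> 'b) \<Rightarrow> (nat \<Rightarrow> real) measure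
     \<Rightarrow> ((nat \<Rightarrow> real) \<Rightarrow> 'b \<Rightarrow> real) \<Rightarrow> bool" where
  "cm_functional \<zeta> b \<gamma> L \<longleftrightarrow>
     (\<lambda>(y, h). L y h) \<in> borel_measurable (data_space \<Otimes>\<^sub>M borel) \<and>
     (\<forall>h \<in> cm_space \<zeta>. \<forall>x. (\<forall>m. x m \<in> span (range b)) \<longrightarrow>
        (\<lambda>m. cm_norm \<zeta> (\<zeta> (x m) - h)) \<longlonglongrightarrow> 0 \<longrightarrow>
        (\<lambda>m. \<integral>\<^sup>+ y. ennreal ((L y h - coord_pairing b y (x m))\<^sup>2) \<partial>\<gamma>) \<longlonglongrightarrow> 0)"

definition potential ::
  "('b::real_inner \<Rightarrow> 'b) \<Rightarrow> ('a \<Rightarrow> 'b) \<Rightarrow> ((nat \<Rightarrow> real) \<Rightarrow> 'b \<Rightarrow> real) \<Rightarrow> nat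
     \<Rightarrow> (nat \<Rightarrow> real) \<Rightarrow> 'a \<Rightarrow> real" where
  "potential \<zeta> G L n y u = real n / 2 * (cm_norm \<zeta> (G u))\<^sup>2 - real n * L y (G u)"

text \<open>The normalising constant is positive, and finite for almost every \<open>y\<close>; on the exceptional
  null set the density below is 0.\<close>

definition posterior ::
  "('b::real_inner \<Rightarrow> 'b) \<Rightarrow> ('a \<Rightarrow> 'b) \<Rightarrow> ((nat \<Rightarrow> real) \<Rightarrow> 'b \<Rightarrow> real) \<Rightarrow> nat
     \<Rightarrow> 'a measure \<Rightarrow> (nat \<Rightarrow> real) \<Rightarrow> 'a measure" where
  "posterior \<zeta> G L n \<mu> y =
     density \<mu> (\<lambda>u. ennreal (exp (- potential \<zeta> G L n y u)) /
                     (\<integral>\<^sup>+ v. ennreal (exp (- potential \<zeta> G L n y v)) \<partial>\<mu>))"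

end

theory Submission
  imports Defs
begin

text \<open>Write \<open>Q v\<close> for the law of the data when the truth is \<open>v\<close>. The vectors \<open>\<zeta> S \<phi>\<^sub>j\<close> give, through
  the Cameron-Martin functional, the linear estimator \<open>u\<^sub>j(y) = \<langle>y, \<zeta> S \<phi>\<^sub>j\<rangle>\<^sub>\<zeta>\<close> of the coordinates
  \<open>\<langle>u, \<phi>\<^sub>j\<rangle>\<close>. Under \<open>Q u\<close> it is unbiased and Gaussian with covariance at most \<open>g\<^sub>k / n\<close>, so that
  its first \<open>k\<^sub>n\<close> coordinates lie within \<open>M\<^sub>1 \<xi>\<^sub>n\<close> of the truth outside an event of probability
  \<open>exp (- (C + 4) n \<epsilon>\<^sub>n\<^sup>2)\<close>. The event that the estimator is close to the projection of \<open>u\<^sub>0\<close> is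
  thus a test against all parameters whose projection is far from that of \<open>u\<^sub>0\<close>. By the
  Cameron-Martin theorem \<open>Q u\<close> has density \<open>exp (- \<Phi>(y, u))\<close> with respect to \<open>Q 0\<close>. Hence,
  on the test event, the expected numerator of the posterior mass of a large ball complement is at
  most \<open>2 exp (- (C + 4) n \<epsilon>\<^sub>n\<^sup>2)\<close> (relative to the likelihood of \<open>u\<^sub>0\<close>), while the denominator
  exceeds \<open>exp (- (C + 2) n \<epsilon>\<^sub>n\<^sup>2)\<close> with probability tending to 1 by the small ball condition.\<close>

section \<open>Square roots of positive operators\<close>

text \<open>The statement rests on definite descriptions and choices (\<open>op_sqrt\<close>,
  \<open>inv_adjoint\<close>, \<open>orth_proj\<close>, \<open>adjoint\<close>), so existence and
  uniqueness come before any estimate; this accounts for the operator theory. The main obstacle is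
  that \<open>L\<close> is fixed only as an L2 limit, separately for each argument: it is not linear
  in its second argument for a given \<open>y\<close>, and it is undetermined on null sets.
  Therefore no identity between values of \<open>L\<close> is used pointwise. Everything is reduced
  to exponential moments of linear combinations, which are stable under L2 limits of Gaussian
  variables. The same reduction yields the Cameron-Martin theorem, as equality of Laplace transforms
  on finitely many coordinates. A single test serves all alternatives, without any covering of the
  parameter set, because the law of the estimation error does not depend on the parameter. Of the 4
  in \<open>C + 4\<close>, two units of exponent are lost to the evidence bound and two remain for
  the decay.\<close>

lemma positive_operator_Cauchy_Schwarz:
  fixes T :: "'a::real_inner \<Rightarrow> 'a"
  assumes lin: "linear T" and sa: "self_adjoint T" and pos: "\<And>x. 0 \<le> T x \<bullet> x"
  shows "(T x \<bullet> y)\<^sup>2 \<le> (T x \<bullet> x) * (T y \<bullet> y)"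
proof -
  define a b c where "a = T x \<bullet> x" and "b = T x \<bullet> y" and "c = T y \<bullet> y"
  have sym: "T y \<bullet> x = b"
    using sa unfolding self_adjoint_def b_def by (metis inner_commute)
  have q: "0 \<le> a + 2 * t * b + t\<^sup>2 * c" for t
  proof -
    have "0 \<le> T (x + t *\<^sub>R y) \<bullet> (x + t *\<^sub>R y)" by (rule pos)
    also have "\<dots> = a + 2 * t * b + t\<^sup>2 * c"
      using sym by (simp add: linear_add[OF lin] linear_scale[OF lin] inner_add_left
          inner_add_right a_def b_def c_def power2_eq_square algebra_simps)
    finally show ?thesis .
  qed
  have "b\<^sup>2 \<le> a * c"
  proof (cases "c = 0")
    case True
    have "b = 0"
    proof (rule ccontr)
      assume "b \<noteq> 0"
      \<comment> \<open>For \<open>c = 0\<close> the polynomial is affine in \<open>t\<close>, and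
        this \<open>t\<close> gives it the value -1.\<close>
      then show False using q[of "- (a + 1) / (2 * b)"] True by (simp add: field_simps)
    qed
    then show ?thesis using True by simp
  next
    case False
    then have c: "c > 0" using pos[of y] by (simp add: c_def)
    have "0 \<le> a + 2 * (- b / c) * b + (- b / c)\<^sup>2 * c" by (rule q)
    also have "\<dots> = a - b\<^sup>2 / c" using c by (simp add: power2_eq_square field_simps)
    finally show ?thesis using c by (simp add: field_simps)
  qed
  then show ?thesis by (simp add: a_def b_def c_def)
qed

lemma positive_operator_null:
  fixes T :: "'a::real_inner \<Rightarrow> 'a"
  assumes "linear T" "self_adjoint T" "\<And>x. 0 \<le> T x \<bullet> x" and "T x \<bullet> x = 0"
  shows "T x = 0"
proof -
  have "(T x \<bullet> T x)\<^sup>2 \<le> 0"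
    using positive_operator_Cauchy_Schwarz[OF assms(1-3), of x "T x"] assms(4) by simp
  then show ?thesis by simp
qed

text \<open>Cauchy-Schwarz for the form of \<open>A\<close> at \<open>x\<close> and
  \<open>A x\<close> bounds the fourth power of \<open>norm (A x)\<close>; no spectral description
  of the operator norm is involved.\<close>

lemma positive_operator_contraction:
  fixes A :: "'a::real_inner \<Rightarrow> 'a"
  assumes "linear A" "self_adjoint A" and pos: "\<And>x. 0 \<le> A x \<bullet> x"
    and le: "\<And>x. A x \<bullet> x \<le> (norm x)\<^sup>2"
  shows "norm (A x) \<le> norm x"
proof -
  have "((norm (A x))\<^sup>2)\<^sup>2 \<le> (A x \<bullet> x) * (A (A x) \<bullet> A x)"
    using positive_operator_Cauchy_Schwarz[OF assms(1,2) pos, of x "A x"]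
    by (simp add: power2_norm_eq_inner)
  also have "\<dots> \<le> (norm x)\<^sup>2 * (norm (A x))\<^sup>2"
    by (intro mult_mono le pos) auto
  finally have "(norm (A x))\<^sup>2 * (norm (A x))\<^sup>2 \<le> (norm x)\<^sup>2 * (norm (A x))\<^sup>2"
    by (simp add: power2_eq_square)
  then have "(norm (A x))\<^sup>2 \<le> (norm x)\<^sup>2 \<or> norm (A x) = 0"
    by (metis mult_right_le_imp_le zero_less_power2)
  then show ?thesis by (auto simp: power2_le_iff_abs_le)
qed

section \<open>The square root of a positive contraction by iteration\<close>

text \<open>Successive approximation for \<open>Y = (A + Y^2) / 2\<close>. The scalar solution
  \<open>1 - sqrt (1 - a)\<close> has a power series with nonnegative coefficients, and likewise
  every iterate and every increment is a polynomial in \<open>A\<close> with nonnegative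
  coefficients.\<close>

primrec sqrt_iter :: "('a::real_vector \<Rightarrow> 'a) \<Rightarrow> nat \<Rightarrow> 'a \<Rightarrow> 'a" where
  "sqrt_iter A 0 x = 0"
| "sqrt_iter A (Suc n) x = (1/2) *\<^sub>R (A x + sqrt_iter A n (sqrt_iter A n x))"

text \<open>The same recursion at the scalar \<open>a = 1\<close>. As the coefficients are
  nonnegative, it dominates the norms of iterates and increments for every contraction
  \<open>A\<close>.\<close>

primrec sqrt_iter_bound :: "nat \<Rightarrow> real" where
  "sqrt_iter_bound 0 = 0"
| "sqrt_iter_bound (Suc n) = (1 + (sqrt_iter_bound n)\<^sup>2) / 2"

lemma sqrt_iter_bound_range: "0 \<le> sqrt_iter_bound n \<and> sqrt_iter_bound n \<le> 1"
proof (induction n)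
  case (Suc n)
  then have "(sqrt_iter_bound n)\<^sup>2 \<le> 1" by (simp add: power_le_one)
  then show ?case by simp
qed simp

lemma sqrt_iter_bound_mono: "sqrt_iter_bound n \<le> sqrt_iter_bound (Suc n)"
proof -
  have "0 \<le> (1 - sqrt_iter_bound n)\<^sup>2" by simp
  then show ?thesis by (simp add: power2_eq_square algebra_simps)
qed

lemma sqrt_iter_linear: "linear A \<Longrightarrow> linear (sqrt_iter A n)"
proof (induction n)
  case 0
  show ?case by (rule linearI) auto
next
  case (Suc n)
  note l = Suc.IH[OF Suc.prems]
  show ?case
    by (rule linearI) (simp_all add: linear_add[OF l] linear_add[OF Suc.prems]
        linear_scale[OF l] linear_scale[OF Suc.prems] algebra_simps)
qed

text \<open>In the limit this makes the root commute with everything that commutes with the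
  operator; uniqueness of the root rests on that.\<close>

lemma sqrt_iter_commute:
  assumes "linear B" "\<And>x. B (A x) = A (B x)"
  shows "B (sqrt_iter A n x) = sqrt_iter A n (B x)"
  by (induction n arbitrary: x)
    (simp_all add: linear_0[OF assms(1)] linear_add[OF assms(1)] linear_scale[OF assms(1)] assms(2))

lemma sqrt_iter_self_adjoint: "self_adjoint A \<Longrightarrow> self_adjoint (sqrt_iter A n)"
  unfolding self_adjoint_def
  by (induction n) (simp_all add: inner_add_left inner_add_right)

lemma sqrt_iter_norm_le:
  assumes "\<And>x. norm (A x) \<le> norm x"
  shows "norm (sqrt_iter A n x) \<le> sqrt_iter_bound n * norm x"
proof (induction n arbitrary: x)
  case (Suc n)
  have "norm (sqrt_iter A n (sqrt_iter A n x)) \<le> sqrt_iter_bound n * norm (sqrt_iter A n x)"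
    by (rule Suc)
  also have "\<dots> \<le> sqrt_iter_bound n * (sqrt_iter_bound n * norm x)"
    by (intro mult_left_mono Suc) (simp add: sqrt_iter_bound_range)
  finally have "norm (A x + sqrt_iter A n (sqrt_iter A n x))
      \<le> norm x + (sqrt_iter_bound n)\<^sup>2 * norm x"
    using assms[of x] norm_triangle_ineq[of "A x" "sqrt_iter A n (sqrt_iter A n x)"]
    by (simp add: power2_eq_square algebra_simps)
  then show ?case by (simp add: algebra_simps del: scaleR_add_right)
qed simp

text \<open>Consecutive iterates commute, so \<open>U^2 - V^2 = (U - V) (U + V)\<close>. The scalar
  recursion has the same factorisation, hence the bound reproduces itself exactly.\<close>

lemma sqrt_iter_diff_le:
  assumes lin: "linear A" and A: "\<And>x. norm (A x) \<le> norm x"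
  shows "norm (sqrt_iter A (Suc n) x - sqrt_iter A n x)
      \<le> (sqrt_iter_bound (Suc n) - sqrt_iter_bound n) * norm x"
proof (induction n arbitrary: x)
  case 0
  show ?case using A[of x] by simp
next
  case (Suc n)
  define U V where "U = sqrt_iter A (Suc n)" and "V = sqrt_iter A n"
  define a b where "a = sqrt_iter_bound (Suc n)" and "b = sqrt_iter_bound n"
  have lU: "linear U" and lV: "linear V"
    unfolding U_def V_def by (rule sqrt_iter_linear[OF lin])+
  have VA: "V (A x) = A (V x)" for x
    unfolding V_def using sqrt_iter_commute[of A A n x] lin by simp
  have UV: "U (V x) = V (U x)" for x
    unfolding U_def using sqrt_iter_commute[of V A, OF lV VA, of "Suc n" x] by simp
  have "sqrt_iter A (Suc (Suc n)) x - U x = (1/2) *\<^sub>R (U (U x) - V (V x))"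
    unfolding U_def V_def by (simp add: algebra_simps)
  also have "U (U x) - V (V x) = U (U x + V x) - V (U x + V x)"
    using UV[of x] by (simp add: linear_add[OF lU] linear_add[OF lV])
  finally have eq: "norm (sqrt_iter A (Suc (Suc n)) x - U x)
      = norm (U (U x + V x) - V (U x + V x)) / 2" by simp
  also have "\<dots> \<le> (a - b) * norm (U x + V x) / 2"
    using Suc[of "U x + V x"] unfolding U_def V_def a_def b_def by (rule divide_right_mono) simp
  also have "\<dots> \<le> (a - b) * ((a + b) * norm x) / 2"
  proof -
    have "norm (U x + V x) \<le> a * norm x + b * norm x"
      unfolding U_def V_def a_def b_def
      by (intro order_trans[OF norm_triangle_ineq] add_mono sqrt_iter_norm_le A)
    moreover have "0 \<le> a - b"
      using sqrt_iter_bound_mono[of n] unfolding a_def b_def by simp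
    ultimately show ?thesis
      by (intro divide_right_mono mult_left_mono) (simp_all add: algebra_simps)
  qed
  also have "\<dots> = (sqrt_iter_bound (Suc (Suc n)) - a) * norm x"
  proof -
    have ab: "sqrt_iter_bound (Suc (Suc n)) = (1 + a\<^sup>2) / 2" "a = (1 + b\<^sup>2) / 2"
      unfolding a_def b_def by simp_all
    have "sqrt_iter_bound (Suc (Suc n)) - a = (1 + a\<^sup>2) / 2 - (1 + b\<^sup>2) / 2"
      using ab by presburger
    also have "\<dots> = (a - b) * (a + b) / 2"
      by (simp add: power2_eq_square field_simps)
    finally show ?thesis by simp
  qed
  finally show ?case unfolding a_def U_def .
qed

lemma sqrt_iter_diff_le':
  assumes lin: "linear A" and A: "\<And>x. norm (A x) \<le> norm x" and "m \<le> n"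
  shows "norm (sqrt_iter A n x - sqrt_iter A m x)
      \<le> (sqrt_iter_bound n - sqrt_iter_bound m) * norm x"
  using \<open>m \<le> n\<close>
proof (induction n rule: dec_induct)
  case (step n)
  have "norm (sqrt_iter A (Suc n) x - sqrt_iter A m x)
      \<le> norm (sqrt_iter A (Suc n) x - sqrt_iter A n x) + norm (sqrt_iter A n x - sqrt_iter A m x)"
    by (metis norm_triangle_ineq diff_add_cancel add_diff_eq)
  also have "\<dots> \<le> (sqrt_iter_bound (Suc n) - sqrt_iter_bound n) * norm x
      + (sqrt_iter_bound n - sqrt_iter_bound m) * norm x"
    by (intro add_mono step sqrt_iter_diff_le lin A)
  finally show ?case by (simp only: left_diff_distrib)
qed simp

text \<open>The scalar sequence is monotone and bounded, hence Cauchy, and its increments dominate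
  those of the iteration.\<close>

lemma sqrt_iter_convergent:
  fixes A :: "'a::{real_inner, complete_space} \<Rightarrow> 'a"
  assumes lin: "linear A" and A: "\<And>x. norm (A x) \<le> norm x"
  shows "convergent (\<lambda>n. sqrt_iter A n x)"
proof -
  have "convergent sqrt_iter_bound"
    by (rule Bseq_mono_convergent)
      (auto intro!: BseqI'[of _ 1] sqrt_iter_bound_mono lift_Suc_mono_le[of sqrt_iter_bound]
        simp: sqrt_iter_bound_range simp del: sqrt_iter_bound.simps)
  then have cauchy: "Cauchy sqrt_iter_bound" by (rule convergent_Cauchy)
  have "Cauchy (\<lambda>n. sqrt_iter A n x)"
  proof (rule CauchyI')
    fix e :: real assume "0 < e"
    then have "0 < e / (norm x + 1)" by (simp add: add_nonneg_pos)
    then obtain N where N: "\<And>m n. m \<ge> N \<Longrightarrow> n \<ge> N \<Longrightarrow>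
        norm (sqrt_iter_bound m - sqrt_iter_bound n) < e / (norm x + 1)"
      using CauchyD[OF cauchy] by blast
    have "norm (sqrt_iter A m x - sqrt_iter A n x) < e" if "N \<le> m" "m < n" for m n
    proof -
      have "norm (sqrt_iter A n x - sqrt_iter A m x)
          \<le> (sqrt_iter_bound n - sqrt_iter_bound m) * norm x"
        by (rule sqrt_iter_diff_le') (use lin A that in auto)
      also have "\<dots> \<le> (e / (norm x + 1)) * norm x"
        using N[of n m] that by (intro mult_right_mono) auto
      also have "\<dots> < e"
      proof -
        have "0 < norm x + 1" by (simp add: add_nonneg_pos)
        with \<open>0 < e\<close> show ?thesis by (simp add: pos_divide_less_eq ring_distribs)
      qed
      finally show ?thesis by (simp add: norm_minus_commute)
    qed
    then show "\<exists>M. \<forall>m\<ge>M. \<forall>n>m. dist (sqrt_iter A m x) (sqrt_iter A n x) < e"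
      unfolding dist_norm by blast
  qed
  then show ?thesis by (simp add: Cauchy_convergent_iff)
qed

text \<open>With \<open>A = I - T\<close>, the limit \<open>Y\<close> of the iteration satisfies \<open>Y = (A + Y\<^sup>2) / 2\<close>, that is
  \<open>(I - Y)\<^sup>2 = T\<close>.\<close>

lemma contraction_sqrt_exists:
  fixes T :: "'a::{real_inner, complete_space} \<Rightarrow> 'a"
  assumes lin: "linear T" and sa: "self_adjoint T" and pos: "\<And>x. 0 \<le> T x \<bullet> x"
    and le: "\<And>x. T x \<bullet> x \<le> (norm x)\<^sup>2"
  obtains R where "bounded_linear R" "self_adjoint R" "\<And>x. 0 \<le> R x \<bullet> x" "\<And>x. R (R x) = T x"
    "\<And>B x. bounded_linear B \<Longrightarrow> (\<And>x. B (T x) = T (B x)) \<Longrightarrow> B (R x) = R (B x)"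
proof -
  define A where "A = (\<lambda>x. x - T x)"
  have linA: "linear A"
    unfolding A_def by (rule linearI) (simp_all add: linear_add[OF lin] linear_scale[OF lin] algebra_simps)
  have saA: "self_adjoint A"
    using sa unfolding A_def self_adjoint_def by (simp add: inner_diff_left inner_diff_right)
  have A: "norm (A x) \<le> norm x" for x
    by (rule positive_operator_contraction[OF linA saA])
      (use pos le in \<open>auto simp: A_def inner_diff_left power2_norm_eq_inner\<close>)
  define Y where "Y = (\<lambda>x. lim (\<lambda>n. sqrt_iter A n x))"
  have Y: "(\<lambda>n. sqrt_iter A n x) \<longlonglongrightarrow> Y x" for x
    unfolding Y_def using sqrt_iter_convergent[OF linA A] by (simp add: convergent_LIMSEQ_iff)
  note sl = sqrt_iter_linear[OF linA]
  have iter_le: "norm (sqrt_iter A n x) \<le> norm x" for n x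
  proof -
    have "norm (sqrt_iter A n x) \<le> sqrt_iter_bound n * norm x" by (rule sqrt_iter_norm_le[OF A])
    also have "\<dots> \<le> 1 * norm x" by (intro mult_right_mono) (auto simp: sqrt_iter_bound_range)
    finally show ?thesis by simp
  qed
  have Y_le: "norm (Y x) \<le> norm x" for x
    by (rule LIMSEQ_le_const2[OF tendsto_norm[OF Y]]) (use iter_le in auto)
  have Y_add: "Y (x + y) = Y x + Y y" for x y
  proof (rule LIMSEQ_unique[OF Y])
    show "(\<lambda>n. sqrt_iter A n (x + y)) \<longlonglongrightarrow> Y x + Y y"
      unfolding linear_add[OF sl] by (intro tendsto_add Y)
  qed
  have Y_scale: "Y (r *\<^sub>R x) = r *\<^sub>R Y x" for r x
  proof (rule LIMSEQ_unique[OF Y])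
    show "(\<lambda>n. sqrt_iter A n (r *\<^sub>R x)) \<longlonglongrightarrow> r *\<^sub>R Y x"
      unfolding linear_scale[OF sl] by (intro tendsto_intros Y)
  qed
  have YY: "Y x = (1/2) *\<^sub>R (A x + Y (Y x))" for x
  proof (rule LIMSEQ_unique)
    show "(\<lambda>n. sqrt_iter A (Suc n) x) \<longlonglongrightarrow> Y x" using Y by (rule LIMSEQ_Suc)
    \<comment> \<open>In the iterated term the inner argument moves with \<open>n\<close>; the
      uniform bound \<open>iter_le\<close> makes the error of replacing it by \<open>Y x\<close>
      vanish.\<close>
    have "(\<lambda>n. sqrt_iter A n (sqrt_iter A n x - Y x)) \<longlonglongrightarrow> 0"
    proof (rule Lim_null_comparison)
      show "\<forall>\<^sub>F n in sequentially. norm (sqrt_iter A n (sqrt_iter A n x - Y x))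
          \<le> norm (sqrt_iter A n x - Y x)"
        using iter_le by simp
      show "(\<lambda>n. norm (sqrt_iter A n x - Y x)) \<longlonglongrightarrow> 0"
        using tendsto_norm[OF tendsto_diff[OF Y[of x] tendsto_const[of "Y x"]]] by simp
    qed
    from tendsto_add[OF this Y[of "Y x"]]
    have "(\<lambda>n. sqrt_iter A n (sqrt_iter A n x)) \<longlonglongrightarrow> Y (Y x)"
      by (simp add: linear_diff[OF sl])
    then show "(\<lambda>n. sqrt_iter A (Suc n) x) \<longlonglongrightarrow> (1/2) *\<^sub>R (A x + Y (Y x))"
      by (simp only: sqrt_iter.simps) (intro tendsto_intros)
  qed
  define R where "R = (\<lambda>x. x - Y x)"
  have "bounded_linear Y"
    by (rule bounded_linear_intro[of _ 1]) (simp_all add: Y_add Y_scale Y_le)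
  then have bl: "bounded_linear R"
    unfolding R_def by (intro bounded_linear_sub bounded_linear_ident)
  have saY: "Y x \<bullet> y = x \<bullet> Y y" for x y
  proof (rule LIMSEQ_unique)
    show "(\<lambda>n. sqrt_iter A n x \<bullet> y) \<longlonglongrightarrow> Y x \<bullet> y" by (intro tendsto_intros Y)
    show "(\<lambda>n. sqrt_iter A n x \<bullet> y) \<longlonglongrightarrow> x \<bullet> Y y"
      using sqrt_iter_self_adjoint[OF saA] unfolding self_adjoint_def by (simp add: tendsto_intros Y)
  qed
  show ?thesis
  proof (rule that[OF bl])
    show "self_adjoint R"
      unfolding R_def self_adjoint_def by (simp add: inner_diff_left inner_diff_right saY)
    show "0 \<le> R x \<bullet> x" for x
    proof -
      have "Y x \<bullet> x \<le> norm (Y x) * norm x" by (rule norm_cauchy_schwarz)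
      also have "\<dots> \<le> norm x * norm x" by (intro mult_right_mono Y_le) simp
      finally show ?thesis
        by (simp add: R_def inner_diff_left power2_norm_eq_inner[symmetric] power2_eq_square)
    qed
    show "R (R x) = T x" for x
    proof -
      have "R (R x) = x - Y x - Y x + Y (Y x)"
        unfolding R_def using Y_add[of "x - Y x" "Y x"] by (simp add: algebra_simps)
      moreover have "Y x + Y x = A x + Y (Y x)"
        using arg_cong[OF YY[of x], of "\<lambda>v. 2 *\<^sub>R v"] by (simp add: scaleR_2)
      ultimately show ?thesis unfolding A_def
        by (metis (no_types, lifting) add_diff_cancel_left' diff_add_cancel diff_diff_eq diff_diff_eq2)
    qed
    show "B (R x) = R (B x)" if B: "bounded_linear B" "\<And>x. B (T x) = T (B x)" for B x
    proof -
      interpret B: bounded_linear B by fact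
      have "B (Y x) = Y (B x)"
      proof (rule LIMSEQ_unique)
        show "(\<lambda>n. B (sqrt_iter A n x)) \<longlonglongrightarrow> B (Y x)" by (intro B.tendsto Y)
        have "B (sqrt_iter A n x) = sqrt_iter A n (B x)" for n
          by (rule sqrt_iter_commute[OF B.linear]) (simp add: A_def B.diff B(2))
        then show "(\<lambda>n. B (sqrt_iter A n x)) \<longlonglongrightarrow> Y (B x)" using Y by simp
      qed
      then show ?thesis unfolding R_def by (simp add: B.diff)
    qed
  qed
qed

text \<open>Division by an operator bound \<open>K\<close> reduces to the contraction case. The
  commutation clause is carried along for the uniqueness proof.\<close>

lemma op_sqrt_exists:
  fixes T :: "'a::{real_inner, complete_space} \<Rightarrow> 'a"
  assumes bl: "bounded_linear T" and sa: "self_adjoint T" and pos: "\<And>x. 0 \<le> T x \<bullet> x"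
  obtains R where "bounded_linear R" "self_adjoint R" "\<And>x. 0 \<le> R x \<bullet> x" "\<And>x. R (R x) = T x"
    "\<And>B x. bounded_linear B \<Longrightarrow> (\<And>x. B (T x) = T (B x)) \<Longrightarrow> B (R x) = R (B x)"
proof -
  obtain K where K: "K > 0" "\<And>x. norm (T x) \<le> norm x * K"
    using bounded_linear.pos_bounded[OF bl] by blast
  define T' where "T' = (\<lambda>x. (1 / K) *\<^sub>R T x)"
  have bl': "bounded_linear T'" unfolding T'_def by (intro bounded_linear_scaleR_right[THEN bounded_linear_compose] bl)
  have le: "T' x \<bullet> x \<le> (norm x)\<^sup>2" for x
  proof -
    have "T x \<bullet> x \<le> norm (T x) * norm x" by (rule norm_cauchy_schwarz)
    also have "\<dots> \<le> (norm x * K) * norm x" by (intro mult_right_mono K) simp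
    finally show ?thesis using K(1) by (simp add: T'_def field_simps power2_eq_square)
  qed
  obtain Q where Q: "bounded_linear Q" "self_adjoint Q" "\<And>x. 0 \<le> Q x \<bullet> x" "\<And>x. Q (Q x) = T' x"
    "\<And>B x. bounded_linear B \<Longrightarrow> (\<And>x. B (T' x) = T' (B x)) \<Longrightarrow> B (Q x) = Q (B x)"
  proof -
    have "linear T'" using bl' by (rule bounded_linear.linear)
    moreover have "self_adjoint T'" using sa unfolding self_adjoint_def T'_def by simp
    moreover have "0 \<le> T' x \<bullet> x" for x using pos K(1) by (simp add: T'_def)
    ultimately show ?thesis using contraction_sqrt_exists[of T'] le that by blast
  qed
  interpret Q: bounded_linear Q by fact
  show ?thesis
  proof (rule that[of "\<lambda>x. sqrt K *\<^sub>R Q x"])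
    show "bounded_linear (\<lambda>x. sqrt K *\<^sub>R Q x)"
      by (intro bounded_linear_scaleR_right[THEN bounded_linear_compose] Q)
    show "self_adjoint (\<lambda>x. sqrt K *\<^sub>R Q x)" using Q(2) unfolding self_adjoint_def by simp
    show "0 \<le> (sqrt K *\<^sub>R Q x) \<bullet> x" for x using Q(3) K(1) by simp
    show "sqrt K *\<^sub>R Q (sqrt K *\<^sub>R Q x) = T x" for x
      using K(1) by (simp add: Q.scale Q(4) T'_def flip: power2_eq_square)
    show "B (sqrt K *\<^sub>R Q x) = sqrt K *\<^sub>R Q (B x)"
      if "bounded_linear B" "\<And>x. B (T x) = T (B x)" for B x
    proof -
      interpret B: bounded_linear B by fact
      have "B (Q x) = Q (B x)" by (rule Q(5)) (simp_all add: T'_def that B.scale)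
      then show ?thesis by (simp add: B.scale)
    qed
  qed
qed

section \<open>The root of the covariance operator\<close>

locale covariance =
  fixes \<zeta> :: "'b::{real_inner, complete_space} \<Rightarrow> 'b"
  assumes cov: "cov_operator \<zeta>"
begin

text \<open>Uniqueness: another root \<open>R'\<close> commutes with its square \<zeta>, hence with
  \<open>R\<close>, so \<open>R + R'\<close> annihilates \<open>y = R x - R' x\<close>. By
  positivity of both roots \<open>R y = 0\<close>, hence \<open>\<zeta> y = 0\<close>, and strict
  positivity of \<zeta> gives \<open>y = 0\<close>.\<close>

lemma op_sqrt_characterization:
  "bounded_linear (op_sqrt \<zeta>) \<and> self_adjoint (op_sqrt \<zeta>) \<and> (\<forall>x. 0 \<le> op_sqrt \<zeta> x \<bullet> x)
    \<and> op_sqrt \<zeta> \<circ> op_sqrt \<zeta> = \<zeta>"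
proof -
  have bl: "bounded_linear \<zeta>" and sa: "self_adjoint \<zeta>" and pd: "\<And>x. x \<noteq> 0 \<Longrightarrow> 0 < \<zeta> x \<bullet> x"
    using cov by (auto simp: cov_operator_def)
  interpret \<zeta>: bounded_linear \<zeta> by (rule bl)
  have pos: "0 \<le> \<zeta> x \<bullet> x" for x using pd[of x] by (cases "x = 0") (auto simp: \<zeta>.zero)
  obtain R where R: "bounded_linear R" "self_adjoint R" "\<And>x. 0 \<le> R x \<bullet> x" "\<And>x. R (R x) = \<zeta> x"
    "\<And>B x. bounded_linear B \<Longrightarrow> (\<And>x. B (\<zeta> x) = \<zeta> (B x)) \<Longrightarrow> B (R x) = R (B x)"
    using op_sqrt_exists[OF bl sa pos] by blast
  interpret R: bounded_linear R by (rule R)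
  have "op_sqrt \<zeta> = R"
    unfolding op_sqrt_def
  proof (rule the_equality)
    show "bounded_linear R \<and> self_adjoint R \<and> (\<forall>x. 0 \<le> R x \<bullet> x) \<and> R \<circ> R = \<zeta>"
      using R by auto
    fix R' assume R': "bounded_linear R' \<and> self_adjoint R' \<and> (\<forall>x. 0 \<le> R' x \<bullet> x) \<and> R' \<circ> R' = \<zeta>"
    then interpret R': bounded_linear R' by simp
    have R'R': "R' (R' x) = \<zeta> x" for x using R' by (auto simp: fun_eq_iff)
    have comm: "R' (R x) = R (R' x)" for x
      by (rule R(5)) (simp_all add: R' flip: R'R')
    show "R' = R"
    proof
      fix x
      define y where "y = R x - R' x"
      have "R y + R' y = 0"
        unfolding y_def by (simp add: R.diff R'.diff R(4) R'R' comm)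
      then have "R y \<bullet> y + R' y \<bullet> y = 0" by (simp flip: inner_add_left)
      with R(3)[of y] R' have "R y \<bullet> y = 0" by (smt (verit))
      then have "R y = 0"
        using positive_operator_null[OF R.linear R(2,3)] by blast
      then have "\<zeta> y = 0" using R(4)[of y] by (simp add: R.zero)
      then have "y = 0" using pd[of y] by auto
      then show "R' x = R x" by (simp add: y_def)
    qed
  qed
  then show ?thesis using R by auto
qed

sublocale root: bounded_linear "op_sqrt \<zeta>"
  using op_sqrt_characterization by blast

lemma root_root: "op_sqrt \<zeta> (op_sqrt \<zeta> x) = \<zeta> x"
  using op_sqrt_characterization by (auto simp: fun_eq_iff)

lemma root_inner: "op_sqrt \<zeta> x \<bullet> y = x \<bullet> op_sqrt \<zeta> y"
  using op_sqrt_characterization by (auto simp: self_adjoint_def)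

lemma root_eq_0_iff: "op_sqrt \<zeta> x = 0 \<longleftrightarrow> x = 0"
  using cov root_root[of x] unfolding cov_operator_def
  by (metis inner_zero_left less_irrefl root.zero)

lemma inj_root: "inj (op_sqrt \<zeta>)"
  by (rule injI) (metis eq_iff_diff_eq_0 root.diff root_eq_0_iff)

lemma inv_root: "inv (op_sqrt \<zeta>) (op_sqrt \<zeta> x) = x"
  by (rule inv_f_f[OF inj_root])

lemma cm_norm_root: "cm_norm \<zeta> (op_sqrt \<zeta> x) = norm x"
  by (simp add: cm_norm_def inv_root)

lemma cov_inner: "\<zeta> x \<bullet> y = op_sqrt \<zeta> x \<bullet> op_sqrt \<zeta> y"
  by (simp add: root_inner flip: root_root)

end

section \<open>Orthonormal bases and adjoints\<close>

lemma orthogonal_to_dense_subspace: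
  assumes "closure (span S) = UNIV" "\<And>s. s \<in> S \<Longrightarrow> x \<bullet> s = 0"
  shows "x = 0"
proof -
  have "closure (span S) \<subseteq> {y. x \<bullet> y = 0}"
  proof (rule closure_minimal)
    show "closed {y. x \<bullet> y = 0}"
      by (intro closed_Collect_eq continuous_intros)
    show "span S \<subseteq> {y. x \<bullet> y = 0}"
      by (rule span_minimal) (auto simp: assms(2) subspace_def inner_add_right)
  qed
  then have "x \<in> {y. x \<bullet> y = 0}" unfolding assms(1) by blast
  then have "x \<bullet> x = 0" by blast
  then show ?thesis by simp
qed

locale onb =
  fixes e :: "nat \<Rightarrow> 'a::{real_inner, complete_space}"
  assumes onb: "orthonormal_basis e"
begin

lemma inner_basis: "e i \<bullet> e j = (if i = j then 1 else 0)"
  using onb by (simp add: orthonormal_basis_def)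

lemma dense: "closure (span (range e)) = UNIV"
  using onb by (simp add: orthonormal_basis_def)

lemma eqI:
  assumes "\<And>i. x \<bullet> e i = y \<bullet> e i"
  shows "x = y"
proof -
  have "x - y = 0"
    by (rule orthogonal_to_dense_subspace[OF dense]) (auto simp: inner_diff_left assms)
  then show ?thesis by simp
qed

lemma inner_sum_basis:
  assumes "finite J"
  shows "(\<Sum>i\<in>J. c i *\<^sub>R e i) \<bullet> e j = (if j \<in> J then c j else 0)"
  using assms by (simp add: inner_sum_left inner_basis if_distrib[where f="\<lambda>x. _ * x"] sum.delta' cong: if_cong)

lemma inner_sum_sum:
  assumes "finite J"
  shows "(\<Sum>i\<in>J. c i *\<^sub>R e i) \<bullet> (\<Sum>i\<in>J. d i *\<^sub>R e i) = (\<Sum>i\<in>J. c i * d i)"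
  unfolding inner_sum_right by (intro sum.cong refl) (simp add: inner_sum_basis assms)

lemma norm_sum_basis:
  assumes "finite J"
  shows "(norm (\<Sum>i\<in>J. c i *\<^sub>R e i))\<^sup>2 = (\<Sum>i\<in>J. (c i)\<^sup>2)"
  unfolding power2_norm_eq_inner inner_sum_sum[OF assms] by (simp add: power2_eq_square)

lemma span_repr:
  assumes "finite J" "x \<in> span (e ` J)"
  shows "x = (\<Sum>i\<in>J. (x \<bullet> e i) *\<^sub>R e i)"
  using assms(2)
proof (induction rule: span_induct_alt)
  case (step c x y)
  then obtain j where j: "j \<in> J" "x = e j" by auto
  have "(\<Sum>i\<in>J. ((c *\<^sub>R x + y) \<bullet> e i) *\<^sub>R e i) = (\<Sum>i\<in>J. (c * (x \<bullet> e i)) *\<^sub>R e i) + y"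
    by (subst (2) step.IH) (simp add: inner_add_left scaleR_add_left sum.distrib)
  also have "(\<Sum>i\<in>J. (c * (x \<bullet> e i)) *\<^sub>R e i) = c *\<^sub>R x"
    using j assms(1) by (simp add: inner_basis if_distrib[where f="\<lambda>x. _ * x"]
        if_distrib[where f="\<lambda>x. x *\<^sub>R _"] sum.delta' cong: if_cong)
  finally show ?case by simp
qed simp

lemma span_range_repr:
  assumes "x \<in> span (range e)"
  obtains J where "finite J" "x = (\<Sum>i\<in>J. (x \<bullet> e i) *\<^sub>R e i)"
proof -
  obtain S where S: "finite S" "S \<subseteq> range e" "x \<in> span S"
    using assms unfolding span_explicit by (fastforce simp: span_explicit)
  then obtain J where "finite J" "S = e ` J" by (meson finite_subset_image)
  with S that span_repr show thesis by blast
qed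

lemma orth_proj_span: "orth_proj (span (e ` {..<k})) u = (\<Sum>i<k. (u \<bullet> e i) *\<^sub>R e i)"
  unfolding orth_proj_def
proof (rule the_equality)
  let ?p = "\<Sum>i<k. (u \<bullet> e i) *\<^sub>R e i"
  have *: "(u - ?p) \<bullet> v = 0" if "v \<in> span (e ` {..<k})" for v
    using that
    by (induction rule: span_induct_alt) (auto simp: inner_add_right inner_diff_left inner_sum_basis)
  have p: "?p \<in> span (e ` {..<k})"
    by (intro span_sum span_scale span_base) auto
  with * show "?p \<in> span (e ` {..<k}) \<and> (\<forall>v\<in>span (e ` {..<k}). (u - ?p) \<bullet> v = 0)" by blast
  fix q assume q: "q \<in> span (e ` {..<k}) \<and> (\<forall>v\<in>span (e ` {..<k}). (u - q) \<bullet> v = 0)"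
  then have "q - ?p \<in> span (e ` {..<k})" using p by (intro span_diff) auto
  then have "(u - ?p) \<bullet> (q - ?p) = 0" "(u - q) \<bullet> (q - ?p) = 0" using * q by auto
  then have "(q - ?p) \<bullet> (q - ?p) = 0" by (simp add: inner_diff_left)
  then show "q = ?p" by simp
qed

text \<open>The representing vector is \<open>\<Sum>i. f (e i) e i\<close>; testing \<open>f\<close> on its partial sums gives
  Bessel's inequality, hence convergence.\<close>

lemma riesz_representation:
  fixes f :: "'a \<Rightarrow> real"
  assumes "bounded_linear f"
  obtains w where "\<And>x. f x = x \<bullet> w"
proof -
  interpret f: bounded_linear f by fact
  obtain K where K: "K > 0" "\<And>x. norm (f x) \<le> norm x * K"
    using f.pos_bounded by blast
  define s where "s n = (\<Sum>i<n. f (e i) *\<^sub>R e i)" for n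
  have fs: "(norm (s n))\<^sup>2 = (\<Sum>i<n. (f (e i))\<^sup>2)" for n
    unfolding s_def by (simp add: norm_sum_basis)
  have bessel: "(\<Sum>i<n. (f (e i))\<^sup>2) \<le> K\<^sup>2" for n
  proof -
    have "f (s n) = (norm (s n))\<^sup>2"
      unfolding fs unfolding s_def by (simp add: f.sum f.scale power2_eq_square)
    then have "norm (s n) * norm (s n) \<le> norm (s n) * K"
      using K(2)[of "s n"] by (simp add: power2_eq_square)
    then have "norm (s n) \<le> K" using K(1) by (cases "norm (s n) = 0") auto
    then show ?thesis by (simp add: power_mono flip: fs)
  qed
  have "summable (\<lambda>i. (f (e i))\<^sup>2)"
    by (rule bounded_imp_summable[of _ "K\<^sup>2"])
      (simp, use bessel in \<open>simp only: flip: lessThan_Suc_atMost\<close>)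
  then have cauchy: "Cauchy (\<lambda>n. \<Sum>i<n. (f (e i))\<^sup>2)"
    by (simp add: summable_iff_convergent convergent_Cauchy)
  have "Cauchy s"
  proof (rule CauchyI')
    fix r :: real assume r: "0 < r"
    then obtain M where M: "\<And>m n. m \<ge> M \<Longrightarrow> n \<ge> M \<Longrightarrow>
        norm ((\<Sum>i<m. (f (e i))\<^sup>2) - (\<Sum>i<n. (f (e i))\<^sup>2)) < r\<^sup>2"
      using CauchyD[OF cauchy, of "r\<^sup>2"] by auto
    have "dist (s m) (s n) < r" if mn: "M \<le> m" "m < n" for m n
    proof -
      have split: "{..<n} = {..<m} \<union> {m..<n}" "{..<m} \<inter> {m..<n} = {}" using mn by auto
      have "s n - s m = (\<Sum>i\<in>{m..<n}. f (e i) *\<^sub>R e i)"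
        unfolding s_def split(1) by (subst sum.union_disjoint) auto
      then have "(norm (s n - s m))\<^sup>2 = (\<Sum>i\<in>{m..<n}. (f (e i))\<^sup>2)"
        by (simp add: norm_sum_basis)
      also have "\<dots> = (\<Sum>i<n. (f (e i))\<^sup>2) - (\<Sum>i<m. (f (e i))\<^sup>2)"
        unfolding split(1) by (subst sum.union_disjoint) auto
      also have "\<dots> < r\<^sup>2" using M[of n m] mn by auto
      finally have "norm (s n - s m) < r" using r by (simp add: power_less_imp_less_base)
      then show ?thesis by (simp add: dist_norm norm_minus_commute)
    qed
    then show "\<exists>M. \<forall>m\<ge>M. \<forall>n>m. dist (s m) (s n) < r" by blast
  qed
  then obtain w where w: "s \<longlonglongrightarrow> w" by (auto simp: Cauchy_convergent_iff convergent_def)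
  have we: "w \<bullet> e j = f (e j)" for j
  proof (rule LIMSEQ_unique)
    show "(\<lambda>n. s n \<bullet> e j) \<longlonglongrightarrow> w \<bullet> e j" by (intro tendsto_intros w)
    have "\<forall>\<^sub>F n in sequentially. s n \<bullet> e j = f (e j)"
      using eventually_gt_at_top[of j] by eventually_elim (simp add: s_def inner_sum_basis)
    then show "(\<lambda>n. s n \<bullet> e j) \<longlonglongrightarrow> f (e j)" by (rule tendsto_eventually)
  qed
  have "closure (span (range e)) \<subseteq> {x. f x = x \<bullet> w}"
  proof (rule closure_minimal)
    show "closed {x. f x = x \<bullet> w}"
      by (intro closed_Collect_eq continuous_intros f.continuous_on)
    show "span (range e) \<subseteq> {x. f x = x \<bullet> w}"
      by (rule span_minimal)
        (auto simp: we subspace_def inner_add_left f.add f.scale f.zero inner_commute[of "e _"])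
  qed
  then show thesis using that dense by blast
qed

text \<open>\<open>adjoint\<close> is a Hilbert choice and has its defining property once some
  witness exists; Riesz representation supplies the value of a witness at each
  \<open>y\<close>.\<close>

lemma adjoint_inner:
  fixes G :: "'a \<Rightarrow> 'b::real_inner"
  assumes "bounded_linear G"
  shows "x \<bullet> adjoint G y = G x \<bullet> y"
proof -
  have "\<exists>w. \<forall>x. G x \<bullet> y = x \<bullet> w" for y
  proof -
    have "bounded_linear (\<lambda>x. G x \<bullet> y)"
      by (rule bounded_linear_compose[OF bounded_linear_inner_left assms])
    then show ?thesis using riesz_representation[of "\<lambda>x. G x \<bullet> y"] by metis
  qed
  then obtain G' where "\<forall>x y. G x \<bullet> y = x \<bullet> G' y" by metis
  then have "\<forall>x y. G x \<bullet> y = x \<bullet> adjoint G y"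
    unfolding adjoint_def by (rule someI[where P="\<lambda>f'. \<forall>x y. G x \<bullet> y = x \<bullet> f' y"])
  then show ?thesis by simp
qed

end

section \<open>Orthogonal complements and density of the range of the root\<close>

text \<open>The projection theorem for the closure of \<open>V\<close>: a sequence in
  \<open>V\<close> minimising the distance to \<open>z\<close> is Cauchy by the parallelogram
  identity, and \<open>z - p\<close> for its limit \<open>p\<close> is the required vector.\<close>

lemma orthogonal_complement_nontrivial:
  fixes V :: "'a::{real_inner, complete_space} set"
  assumes V: "subspace V" and z: "z \<notin> closure V"
  obtains w where "w \<noteq> 0" "\<And>v. v \<in> V \<Longrightarrow> w \<bullet> v = 0"
proof -
  define d where "d = infdist z V"
  have Vne: "V \<noteq> {}" using V subspace_0 by blast
  have d_le: "d \<le> norm (z - v)" if "v \<in> V" for v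
    using infdist_le[OF that, of z] by (simp add: d_def dist_norm)
  have d0: "d \<ge> 0" by (simp add: d_def infdist_nonneg)
  have "\<exists>v\<in>V. norm (z - v) < d + 1 / real (Suc n)" for n
  proof (rule ccontr)
    assume "\<not> ?thesis"
    then have "d + 1 / real (Suc n) \<le> infdist z V"
      using Vne unfolding infdist_notempty[OF Vne] by (intro cINF_greatest) (auto simp: dist_norm not_less)
    then show False by (simp add: d_def)
  qed
  then obtain v where vV: "\<And>n. v n \<in> V" and v: "\<And>n. norm (z - v n) < d + 1 / real (Suc n)"
    by metis
  have lim_up: "(\<lambda>n. d + 1 / real (Suc n)) \<longlonglongrightarrow> d"
    using tendsto_add[OF tendsto_const[of d] LIMSEQ_inverse_real_of_nat]
    by (simp add: inverse_eq_divide)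
  have norm_lim: "(\<lambda>n. norm (z - v n)) \<longlonglongrightarrow> d"
    by (rule tendsto_sandwich[OF _ _ tendsto_const lim_up])
      (auto intro!: always_eventually d_le vV less_imp_le[OF v] simp del: of_nat_Suc)
  have par: "(norm (v m - v n))\<^sup>2 \<le> 2 * ((norm (z - v m))\<^sup>2 - d\<^sup>2) + 2 * ((norm (z - v n))\<^sup>2 - d\<^sup>2)" for m n
  proof -
    define c where "c = (1/2) *\<^sub>R (v m + v n)"
    have "c \<in> V" unfolding c_def by (intro subspace_scale subspace_add V vV)
    then have "d\<^sup>2 \<le> (norm (z - c))\<^sup>2" using d_le d0 by (intro power_mono) auto
    moreover have "(norm (v m - v n))\<^sup>2 + 4 * (norm (z - c))\<^sup>2
        = 2 * (norm (z - v m))\<^sup>2 + 2 * (norm (z - v n))\<^sup>2"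
      unfolding c_def power2_norm_eq_inner
      by (simp add: inner_simps inner_commute field_simps)
    ultimately show ?thesis by simp
  qed
  have "(\<lambda>n. (norm (z - v n))\<^sup>2 - d\<^sup>2) \<longlonglongrightarrow> d\<^sup>2 - d\<^sup>2"
    by (intro tendsto_intros norm_lim)
  then have sq: "(\<lambda>n. (norm (z - v n))\<^sup>2 - d\<^sup>2) \<longlonglongrightarrow> 0" by simp
  have "Cauchy v"
  proof (rule CauchyI')
    fix r :: real assume r: "0 < r"
    then have "\<forall>\<^sub>F n in sequentially. (norm (z - v n))\<^sup>2 - d\<^sup>2 < r\<^sup>2 / 4"
      using order_tendstoD(2)[OF sq, of "r\<^sup>2 / 4"] by simp
    then obtain M where M: "\<And>n. n \<ge> M \<Longrightarrow> (norm (z - v n))\<^sup>2 - d\<^sup>2 < r\<^sup>2 / 4"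
      unfolding eventually_sequentially by blast
    have "dist (v m) (v n) < r" if "M \<le> m" "m < n" for m n
    proof -
      have "(norm (v m - v n))\<^sup>2 < r\<^sup>2" using par[of m n] M[of m] M[of n] that by (auto simp: field_simps)
      then show ?thesis using r by (simp add: dist_norm power_less_imp_less_base)
    qed
    then show "\<exists>M. \<forall>m\<ge>M. \<forall>n>m. dist (v m) (v n) < r" by blast
  qed
  then obtain p where p: "v \<longlonglongrightarrow> p" by (auto simp: Cauchy_convergent_iff convergent_def)
  have pd: "norm (z - p) = d"
    by (rule LIMSEQ_unique[OF _ norm_lim]) (intro tendsto_intros p)
  have pV: "p \<in> closure V" using p vV closure_sequential by blast
  have "(z - p) \<bullet> u = 0" if u: "u \<in> V" for u
  proof (cases "u = 0")
    case False
    \<comment> \<open>The minimiser of the distance from \<open>z\<close> to the line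
      \<open>p + t u\<close>; minimality of \<open>p\<close> leaves no room for improvement.\<close>
    define t where "t = (z - p) \<bullet> u / (u \<bullet> u)"
    have "(\<lambda>n. norm (z - (v n + t *\<^sub>R u))) \<longlonglongrightarrow> norm (z - (p + t *\<^sub>R u))"
      by (intro tendsto_intros p)
    moreover have "d \<le> norm (z - (v n + t *\<^sub>R u))" for n
      by (intro d_le subspace_add subspace_scale V vV u)
    ultimately have "d \<le> norm (z - (p + t *\<^sub>R u))"
      by (intro LIMSEQ_le_const) auto
    then have "d\<^sup>2 \<le> (norm (z - (p + t *\<^sub>R u)))\<^sup>2" using d0 by (intro power_mono) auto
    also have "\<dots> = d\<^sup>2 - 2 * t * ((z - p) \<bullet> u) + t\<^sup>2 * (u \<bullet> u)"
      unfolding pd[symmetric] power2_norm_eq_inner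
      by (simp add: inner_simps inner_commute power2_eq_square algebra_simps)
    also have "\<dots> = d\<^sup>2 - ((z - p) \<bullet> u)\<^sup>2 / (u \<bullet> u)"
      using False by (simp add: t_def power2_eq_square field_simps)
    finally have "((z - p) \<bullet> u)\<^sup>2 \<le> 0" using False inner_gt_zero_iff[of u]
      by (simp add: divide_le_0_iff del: inner_gt_zero_iff)
    then show ?thesis by simp
  qed simp
  moreover have "z - p \<noteq> 0" using pV z by auto
  ultimately show thesis using that by blast
qed

text \<open>A vector orthogonal to the range lies in the kernel of the self-adjoint root, and that
  kernel is trivial.\<close>

lemma (in covariance) range_root_dense: "closure (range (op_sqrt \<zeta>)) = UNIV"
proof (rule ccontr)
  assume "closure (range (op_sqrt \<zeta>)) \<noteq> UNIV"
  then obtain z where z: "z \<notin> closure (range (op_sqrt \<zeta>))" by blast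
  have "subspace (range (op_sqrt \<zeta>))"
    by (simp add: linear_subspace_image root.linear)
  from orthogonal_complement_nontrivial[OF this z]
  obtain w where w: "w \<noteq> 0" "\<And>v. v \<in> range (op_sqrt \<zeta>) \<Longrightarrow> w \<bullet> v = 0" by blast
  have "op_sqrt \<zeta> w \<bullet> op_sqrt \<zeta> w = w \<bullet> op_sqrt \<zeta> (op_sqrt \<zeta> w)" by (rule root_inner)
  also have "\<dots> = 0" using w(2) by blast
  finally show False using w(1) root_eq_0_iff by simp
qed

section \<open>Measures determined by their Laplace transforms\<close>

text \<open>Once the lower coefficients vanish, division by \<open>t ^ n\<close> and the limit at 0
  isolate the coefficient of index \<open>n\<close>.\<close>

lemma powser_eq_0_imp_coeff_0:
  fixes c :: "nat \<Rightarrow> real"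
  assumes "\<And>t. (\<lambda>k. c k * t ^ k) sums 0"
  shows "c n = 0"
proof (induction n rule: less_induct)
  case (less n)
  have "(\<lambda>k. c (k + n) * t ^ k) sums 0" if "t \<noteq> 0" for t
  proof -
    have "(\<lambda>k. c (k + n) * t ^ (k + n)) sums (0 - (\<Sum>i<n. c i * t ^ i))"
      using assms[of t] sums_iff_shift[of "\<lambda>k. c k * t ^ k" n] by auto
    then have "(\<lambda>k. (c (k + n) * t ^ k) * t ^ n) sums 0"
      using less by (simp add: power_add mult.assoc)
    then have "(\<lambda>k. (c (k + n) * t ^ k) * t ^ n / t ^ n) sums (0 / t ^ n)"
      by (rule sums_divide)
    then show ?thesis using that by simp
  qed
  then have "((\<lambda>_. 0) \<longlongrightarrow> c (0 + n)) (at (0::real))"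
    by (intro powser_limit_0_strong[of 1 "\<lambda>k. c (k + n)"]) auto
  then show ?case
    using tendsto_unique[OF _ _ tendsto_const[of "0::real"], of "at (0::real)" "c n"] by simp
qed

locale laplace_finite = finite_measure M for M :: "real measure" +
  assumes sets_M [measurable_cong]: "sets M = sets borel"
    and mgf_finite: "\<And>t. (\<integral>\<^sup>+x. ennreal (exp (t * x)) \<partial>M) < \<infinity>"
begin

lemma integrable_exp_abs: "integrable M (\<lambda>x. exp (t * \<bar>x\<bar>))"
proof (rule Bochner_Integration.integrable_bound)
  have i: "integrable M (\<lambda>x. exp (t * x))" for t
    by (rule integrableI_bounded) (use mgf_finite in auto)
  show "integrable M (\<lambda>x. exp (t * x) + exp ((- t) * x))"
    by (intro Bochner_Integration.integrable_add i)
  show "AE x in M. norm (exp (t * \<bar>x\<bar>)) \<le> norm (exp (t * x) + exp ((- t) * x))"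
  proof (intro AE_I2)
    fix x
    show "norm (exp (t * \<bar>x\<bar>)) \<le> norm (exp (t * x) + exp ((- t) * x))"
      using exp_gt_zero[of "t * x"] exp_gt_zero[of "- (t * x)"] unfolding abs_if real_norm_def
      by (smt (verit) minus_mult_left mult_minus_right)
  qed
qed simp

text \<open>The parameter is complex so that one series covers the Laplace transform at real
  \<open>z\<close> and the characteristic function at imaginary \<open>z\<close>. The moments then
  take the place of analytic continuation.\<close>

lemma moment_series:
  fixes z :: complex
  shows "(\<lambda>k. z ^ k / fact k * complex_of_real (\<integral>x. x ^ k \<partial>M)) sums
      (CLINT x|M. exp (z * complex_of_real x))"
proof -
  define f :: "nat \<Rightarrow> real \<Rightarrow> complex" where "f = (\<lambda>k x. z ^ k / fact k * complex_of_real (x ^ k))"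
  have f_sums: "(\<lambda>k. f k x) sums exp (z * complex_of_real x)" for x
    using exp_converges[of "z * complex_of_real x"]
    by (simp add: f_def power_mult_distrib scaleR_conv_of_real field_simps)
  have nf: "norm (f k x) = (norm z * \<bar>x\<bar>) ^ k / fact k" for k x
    by (simp add: f_def norm_mult norm_divide norm_power power_mult_distrib)
  have nf_sums: "(\<lambda>k. norm (f k x)) sums exp (norm z * \<bar>x\<bar>)" for x
    using exp_converges[of "norm z * \<bar>x\<bar>"] unfolding nf by (simp add: divide_inverse mult.commute)
  have partial: "(\<Sum>k<n. norm (f k x)) \<le> exp (norm z * \<bar>x\<bar>)" for n x
    using sum_le_suminf[OF sums_summable[OF nf_sums], of "{..<n}" x] sums_unique[OF nf_sums, of x]
    by auto
  have le: "norm (f k x) \<le> exp (norm z * \<bar>x\<bar>)" for k x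
    using partial[of x "Suc k"] sum_nonneg[of "{..<k}" "\<lambda>k. norm (f k x)"] by simp
  have meas [measurable]: "f k \<in> borel_measurable M" for k
    unfolding f_def by measurable
  have int: "integrable M (f k)" for k
    by (rule Bochner_Integration.integrable_bound[OF integrable_exp_abs[of "norm z"]])
      (use le in auto)
  have "(\<lambda>k. integral\<^sup>L M (f k)) sums (\<integral>x. (\<Sum>k. f k x) \<partial>M)"
  proof (rule sums_integral[OF int])
    show "AE x in M. summable (\<lambda>k. norm (f k x))"
      using nf_sums by (auto intro: sums_summable)
    show "summable (\<lambda>k. \<integral>x. norm (f k x) \<partial>M)"
    proof (rule bounded_imp_summable)
      show "(\<Sum>k\<le>n. \<integral>x. norm (f k x) \<partial>M) \<le> (\<integral>x. exp (norm z * \<bar>x\<bar>) \<partial>M)" for n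
        using partial[of _ "Suc n"] unfolding lessThan_Suc_atMost
        by (subst Bochner_Integration.integral_sum[symmetric])
          (auto intro!: integral_mono integrable_norm int integrable_exp_abs
            Bochner_Integration.integrable_sum)
    qed auto
  qed
  moreover have "(\<lambda>x. \<Sum>k. f k x) = (\<lambda>x. exp (z * complex_of_real x))"
    using f_sums by (auto simp: sums_iff)
  moreover have "integral\<^sup>L M (f k) = z ^ k / fact k * complex_of_real (\<integral>x. x ^ k \<partial>M)" for k
    unfolding f_def by (simp del: of_real_power)
  ultimately show ?thesis by simp
qed

end

lemma moments_eq:
  assumes "laplace_finite M" "laplace_finite N"
    and eq: "\<And>t. (\<integral>\<^sup>+x. ennreal (exp (t * x)) \<partial>M) = (\<integral>\<^sup>+x. ennreal (exp (t * x)) \<partial>N)"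
  shows "(\<integral>x. x ^ k \<partial>M) = (\<integral>x. x ^ k \<partial>N)"
proof -
  interpret M: laplace_finite M by fact
  interpret N: laplace_finite N by fact
  have real_eq: "(\<integral>x. exp (t * x) \<partial>M) = (\<integral>x. exp (t * x) \<partial>N)" for t
    using eq[of t] by (simp add: integral_eq_nn_integral)
  have series: "(\<lambda>k. (1 / fact k * (\<integral>x. x ^ k \<partial>K)) * t ^ k) sums (\<integral>x. exp (t * x) \<partial>K)"
    if "laplace_finite K" for K t
  proof -
    have "(\<lambda>k. complex_of_real ((1 / fact k * (\<integral>x. x ^ k \<partial>K)) * t ^ k))
        sums (CLINT x|K. complex_of_real (exp (t * x)))"
      using laplace_finite.moment_series[OF that, of "complex_of_real t"]
      by (simp add: exp_of_real mult_ac flip: of_real_mult of_real_power)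
    then have "(\<lambda>k. complex_of_real ((1 / fact k * (\<integral>x. x ^ k \<partial>K)) * t ^ k))
        sums complex_of_real (\<integral>x. exp (t * x) \<partial>K)"
      by simp
    then show ?thesis by (rule iffD1[OF sums_of_real_iff])
  qed
  have "(1 / fact k * (\<integral>x. x ^ k \<partial>M)) - (1 / fact k * (\<integral>x. x ^ k \<partial>N)) = 0"
  proof (rule powser_eq_0_imp_coeff_0[of "\<lambda>k. (1 / fact k * (\<integral>x. x ^ k \<partial>M)) - (1 / fact k * (\<integral>x. x ^ k \<partial>N))"])
    fix t
    show "(\<lambda>k. ((1 / fact k * (\<integral>x. x ^ k \<partial>M)) - (1 / fact k * (\<integral>x. x ^ k \<partial>N))) * t ^ k) sums 0"
      using sums_diff[OF series[OF assms(1), of t] series[OF assms(2), of t]] real_eq[of t]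
      by (simp only: left_diff_distrib diff_self)
  qed
  then show ?thesis by simp
qed

text \<open>Equal Laplace transforms give equal moments and so equal characteristic functions.
  Levy's theorem concerns probability measures, whence the normalisation by the total mass and the
  separate case of mass 0.\<close>

lemma laplace_unique:
  assumes lM: "laplace_finite M" and lN: "laplace_finite N"
    and eq: "\<And>t. (\<integral>\<^sup>+x. ennreal (exp (t * x)) \<partial>M) = (\<integral>\<^sup>+x. ennreal (exp (t * x)) \<partial>N)"
  shows "M = N"
proof -
  interpret M: laplace_finite M by fact
  interpret N: laplace_finite N by fact
  have mass: "emeasure M (space M) = emeasure N (space N)"
    using eq[of 0] by simp
  then have mass': "measure M (space M) = measure N (space N)" by (simp add: measure_def)
  have char_eq: "(CLINT x|M. iexp (t * x)) = (CLINT x|N. iexp (t * x))" for t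
    using sums_unique2[OF M.moment_series[of "\<i> * t"] N.moment_series[of "\<i> * t", folded moments_eq[OF lM lN eq]]]
    by (simp add: mult.assoc)
  show ?thesis
  proof (cases "measure M (space M) = 0")
    case True
    then have "emeasure M (space M) = 0" "emeasure N (space N) = 0"
      using mass' by (simp_all add: M.emeasure_eq_measure N.emeasure_eq_measure)
    then have "emeasure M A = 0" "emeasure N A = 0" for A
      by (metis emeasure_space le_zero_eq)+
    then show ?thesis by (intro measure_eqI) (simp_all add: M.sets_M N.sets_M)
  next
    case False
    define c where "c = measure M (space M)"
    have c: "c > 0" using False by (simp add: c_def zero_less_measure_iff)
    have norm_dist: "real_distribution (density K (\<lambda>_. ennreal (1 / c)))"
      if K: "laplace_finite K" "measure K (space K) = c" for K
    proof -
      interpret K: laplace_finite K by fact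
      show ?thesis
      proof (intro real_distribution.intro prob_spaceI real_distribution_axioms.intro)
        show "emeasure (density K (\<lambda>_. ennreal (1 / c))) (space (density K (\<lambda>_. ennreal (1 / c)))) = 1"
          using c K(2) by (simp add: emeasure_density K.emeasure_eq_measure flip: ennreal_mult')
      qed (simp_all add: K.sets_M)
    qed
    have "density M (\<lambda>_. ennreal (1 / c)) = density N (\<lambda>_. ennreal (1 / c))"
    proof (rule Levy_uniqueness)
      show "char (density M (\<lambda>_. ennreal (1 / c))) = char (density N (\<lambda>_. ennreal (1 / c)))"
        using c char_eq by (simp add: char_def integral_density fun_eq_iff)
    qed (use norm_dist lM lN mass' c_def in auto)
    then have eq': "ennreal (1 / c) * emeasure M A = ennreal (1 / c) * emeasure N A" if "A \<in> sets borel" for A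
      by (metis M.sets_M N.sets_M emeasure_density_const that)
    have "emeasure M A = emeasure N A" if "A \<in> sets borel" for A
      using eq'[OF that] c by (simp add: ennreal_mult_cancel_left)
    then show ?thesis by (intro measure_eqI) (simp_all add: M.sets_M N.sets_M)
  qed
qed

text \<open>Exponential weights are traded for indicators one coordinate at a time. With the
  coordinates in \<open>J\<close> already traded, the weighted marginal of coordinate
  \<open>m\<close> has its Laplace transform given by the induction hypothesis with \<open>m\<close>
  added to the exponent, so the one-dimensional theorem applies to it.\<close>

lemma laplace_unique_PiM:
  fixes M N :: "(nat \<Rightarrow> real) measure"
  assumes M: "finite_measure M" "sets M = sets data_space"
    and N: "finite_measure N" "sets N = sets data_space"
    and eq: "\<And>J c. finite J \<Longrightarrow> (\<integral>\<^sup>+y. ennreal (exp (\<Sum>i\<in>J. c i * y i)) \<partial>M)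
        = (\<integral>\<^sup>+y. ennreal (exp (\<Sum>i\<in>J. c i * y i)) \<partial>N)"
    and fin: "\<And>J c. finite J \<Longrightarrow> (\<integral>\<^sup>+y. ennreal (exp (\<Sum>i\<in>J. c i * y i)) \<partial>M) < \<infinity>"
  shows "M = N"
proof -
  note [measurable_cong] = M(2) N(2)
  define W where "W A J K c y = (\<Prod>j\<in>J. indicator (A j) (y j) :: ennreal) * ennreal (exp (\<Sum>i\<in>K. c i * y i))"
    for A :: "nat \<Rightarrow> real set" and J K c and y :: "nat \<Rightarrow> real"
  have W_meas: "W A J K c \<in> borel_measurable data_space"
    if [measurable]: "\<And>j. A j \<in> sets borel" for A J K c
    unfolding W_def by measurable
  \<comment> \<open>The index \<open>m\<close> may already occur in \<open>K\<close>; then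
    \<open>t\<close> is added to its coefficient.\<close>
  have W_exp: "W A J K c y * ennreal (exp (t * y m))
      = W A J (insert m K) (\<lambda>i. (if i \<in> K then c i else 0) + (if i = m then t else 0)) y"
    if K: "finite K" for A J K c t m y
  proof -
    have "(\<Sum>i\<in>insert m K. ((if i \<in> K then c i else 0) + (if i = m then t else 0)) * y i)
        = (\<Sum>i\<in>insert m K. (if i \<in> K then c i * y i else 0)) + (\<Sum>i\<in>insert m K. (if i = m then t * y i else 0))"
      unfolding sum.distrib[symmetric] by (intro sum.cong) (auto simp: distrib_right)
    also have "(\<Sum>i\<in>insert m K. (if i \<in> K then c i * y i else 0)) = (\<Sum>i\<in>K. c i * y i)"
      using K by (intro sum.mono_neutral_cong_right) auto
    also have "(\<Sum>i\<in>insert m K. (if i = m then t * y i else 0)) = t * y m"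
      using K by (subst sum.delta) auto
    finally show ?thesis
      by (simp add: W_def exp_add mult.assoc flip: ennreal_mult)
  qed
  have W_le: "W A J K c y \<le> ennreal (exp (\<Sum>i\<in>K. c i * y i))" for A J K c y
  proof -
    have "(\<Prod>j\<in>J. indicator (A j) (y j) :: ennreal) \<le> 1"
      by (intro prod_le_1) (auto split: split_indicator)
    then show ?thesis unfolding W_def using mult_right_mono by fastforce
  qed
  have key: "(\<integral>\<^sup>+y. W A J K c y \<partial>M) = (\<integral>\<^sup>+y. W A J K c y \<partial>N)"
    if "finite J" and A: "\<And>j. A j \<in> sets borel" and "finite K" for A J K c
    using \<open>finite J\<close> \<open>finite K\<close>
  proof (induction J arbitrary: K c)
    case empty
    then show ?case using eq by (simp add: W_def)
  next
    case (insert m J)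
    note [measurable] = A W_meas[OF A]
    define D where "D Q = distr (density Q (W A J K c)) borel (\<lambda>y. y m)" for Q
    have D_int: "(\<integral>\<^sup>+x. f x \<partial>D Q) = (\<integral>\<^sup>+y. W A J K c y * f (y m) \<partial>Q)"
      if [measurable_cong]: "sets Q = sets data_space" and [measurable]: "f \<in> borel_measurable borel" for Q f
      unfolding D_def by (simp add: nn_integral_distr nn_integral_density)
    have D_mgf: "(\<integral>\<^sup>+x. ennreal (exp (t * x)) \<partial>D Q) = (\<integral>\<^sup>+y. W A J (Set.insert m K)
        (\<lambda>i. (if i \<in> K then c i else 0) + (if i = m then t else 0)) y \<partial>Q)"
      if "sets Q = sets data_space" for Q t
      using that insert.prems by (simp add: D_int W_exp)
    have fin': "(\<integral>\<^sup>+x. ennreal (exp (t * x)) \<partial>D Q) < \<infinity>" if "Q = M \<or> Q = N" for Q t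
    proof -
      have "(\<integral>\<^sup>+x. ennreal (exp (t * x)) \<partial>D Q) \<le> (\<integral>\<^sup>+y. ennreal (exp (\<Sum>i\<in>Set.insert m K.
          ((if i \<in> K then c i else 0) + (if i = m then t else 0)) * y i)) \<partial>Q)"
        using that M N by (subst D_mgf) (auto intro!: nn_integral_mono W_le)
      also have "\<dots> < \<infinity>" proof -
        have "finite (Set.insert m K)" using insert.prems by simp
        from fin[OF this] eq[OF this] show ?thesis using that by auto
      qed
      finally show ?thesis .
    qed
    have lap: "laplace_finite (D Q)" if "Q = M \<or> Q = N" for Q
    proof (intro laplace_finite.intro laplace_finite_axioms.intro finite_measureI)
      show "emeasure (D Q) (space (D Q)) \<noteq> \<infinity>"
        using fin'[OF that, of 0] by simp
      show "sets (D Q) = sets borel" by (simp add: D_def)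
    qed (rule fin'[OF that])
    have "D M = D N"
    proof (rule laplace_unique)
      show "(\<integral>\<^sup>+x. ennreal (exp (t * x)) \<partial>D M) = (\<integral>\<^sup>+x. ennreal (exp (t * x)) \<partial>D N)" for t
        using M N insert by (simp add: D_mgf)
    qed (auto intro: lap)
    then have "(\<integral>\<^sup>+x. indicator (A m) x \<partial>D M) = (\<integral>\<^sup>+x. indicator (A m) x \<partial>D N)" by simp
    then show ?case
      using M N insert.hyps by (simp add: D_int W_def mult_ac)
  qed
  show ?thesis
  proof (rule measure_eqI_PiM_infinite)
    show "sets M = sets data_space" "sets N = sets data_space" "finite_measure M" by fact+
    fix A :: "nat \<Rightarrow> real set" and J :: "nat set"
    assume J: "finite J" and A: "\<And>i. i \<in> J \<Longrightarrow> A i \<in> sets borel"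
    \<comment> \<open>\<open>key\<close> asks for measurable components at all indices, while
      \<open>A\<close> is only known to be measurable on \<open>J\<close>.\<close>
    define A' where "A' i = (if i \<in> J then A i else {})" for i
    have A': "A' i \<in> sets borel" for i using A by (simp add: A'_def)
    have ind: "W A' J {} (\<lambda>_. 0) y = indicator (prod_emb UNIV (\<lambda>_. borel) J (Pi\<^sub>E J A)) y" for y
      using J by (auto simp: W_def A'_def prod_emb_def PiE_iff indicator_def prod_zero_iff)
    have [measurable]: "prod_emb UNIV (\<lambda>_. borel) J (Pi\<^sub>E J A) \<in> sets data_space"
      using J A by (intro sets_PiM_I) auto
    show "emeasure M (prod_emb UNIV (\<lambda>_. borel) J (Pi\<^sub>E J A))
        = emeasure N (prod_emb UNIV (\<lambda>_. borel) J (Pi\<^sub>E J A))"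
      using key[of J A' "{}" "\<lambda>_. 0"] J A' by (simp add: ind M N)
  qed
qed

section \<open>Gaussian limits in \<open>L\<^sup>2\<close>\<close>

lemma std_normal_prob: "prob_space std_normal_distribution"
  using real_dist_normal_dist by (simp add: real_distribution_def)

text \<open>Scaling a standard normal variable includes the degenerate variance 0, so the later
  computations need no case distinction.\<close>

lemma centered_normal_eq_distr:
  assumes "v \<ge> 0"
  shows "centered_normal v = distr std_normal_distribution borel (\<lambda>x. sqrt v * x)"
proof (cases "v = 0")
  case True
  interpret prob_space std_normal_distribution by (rule std_normal_prob)
  show ?thesis
    unfolding centered_normal_def using True
    by (intro measure_eqI) (auto simp: emeasure_distr emeasure_space_1[simplified] split: split_indicator)
next
  case False
  interpret prob_space std_normal_distribution by (rule std_normal_prob)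
  have "distributed std_normal_distribution lborel (\<lambda>x. x) (normal_density 0 1)"
    by (auto simp: distributed_def distr_id2)
  from normal_density_affine[OF this, of "sqrt v" 0]
  have "distr std_normal_distribution lborel (\<lambda>x. sqrt v * x) = density lborel (normal_density 0 (sqrt v))"
    using assms False by (simp add: distributed_def)
  moreover have "distr std_normal_distribution lborel (\<lambda>x. sqrt v * x)
      = distr std_normal_distribution borel (\<lambda>x. sqrt v * x)"
    by (rule distr_cong) auto
  ultimately show ?thesis using False by (simp add: centered_normal_def)
qed

lemma real_distribution_centered_normal: "v \<ge> 0 \<Longrightarrow> real_distribution (centered_normal v)"
  unfolding centered_normal_eq_distr
  by (rule prob_space.real_distribution_distr[OF std_normal_prob]) simp

lemma char_centered_normal:
  assumes "v \<ge> 0"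
  shows "char (centered_normal v) t = exp (- (v * t\<^sup>2) / 2)"
proof -
  have "char (centered_normal v) t = char std_normal_distribution (t * sqrt v)"
    unfolding char_def centered_normal_eq_distr[OF assms]
    by (subst integral_distr) (auto simp: mult.assoc)
  then show ?thesis
    using assms unfolding char_std_normal_distribution
    by (simp add: power_mult_distrib mult.commute)
qed

lemma std_normal_mgf:
  "(\<integral>\<^sup>+x. ennreal (exp (s * x)) \<partial>std_normal_distribution) = ennreal (exp (s\<^sup>2 / 2))"
proof -
  have eq: "std_normal_density x * exp (s * x) = exp (s\<^sup>2 / 2) * normal_density s 1 x" for x
  proof -
    have "exp (- x\<^sup>2 / 2) * exp (s * x) = exp (s\<^sup>2 / 2) * exp (- (x - s)\<^sup>2 / 2)"
      unfolding exp_add[symmetric] by (simp add: power2_eq_square field_simps)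
    then show ?thesis by (simp add: normal_density_def field_simps)
  qed
  interpret N: prob_space "density lborel (normal_density s 1)"
    by (rule prob_space_normal_density) simp
  have one: "(\<integral>\<^sup>+x. ennreal (normal_density s 1 x) \<partial>lborel) = 1"
    using N.emeasure_space_1 by (simp add: emeasure_density)
  have "(\<integral>\<^sup>+x. ennreal (exp (s * x)) \<partial>std_normal_distribution)
      = (\<integral>\<^sup>+x. ennreal (exp (s\<^sup>2 / 2)) * ennreal (normal_density s 1 x) \<partial>lborel)"
    by (subst nn_integral_density) (auto intro!: nn_integral_cong simp: eq simp flip: ennreal_mult')
  also have "\<dots> = ennreal (exp (s\<^sup>2 / 2))"
    by (subst nn_integral_cmult) (auto simp: one)
  finally show ?thesis .
qed

lemma centered_normal_mgf:
  assumes "v \<ge> 0"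
  shows "(\<integral>\<^sup>+x. ennreal (exp (s * x)) \<partial>centered_normal v) = ennreal (exp (s\<^sup>2 * v / 2))"
  unfolding centered_normal_eq_distr[OF assms]
  using std_normal_mgf[of "s * sqrt v"] assms
  by (subst nn_integral_distr) (auto simp: power_mult_distrib mult.assoc)

text \<open>Since \<open>iexp\<close> is Lipschitz, L2 convergence forces convergence of
  characteristic functions, while those of the approximants converge along with the
  variances.\<close>

lemma (in prob_space) distr_L2_limit_normal:
  assumes [measurable]: "X \<in> borel_measurable M" "\<And>m. Y m \<in> borel_measurable M"
    and L2: "(\<lambda>m. \<integral>\<^sup>+\<omega>. ennreal ((X \<omega> - Y m \<omega>)\<^sup>2) \<partial>M) \<longlonglongrightarrow> 0"
    and normal: "\<And>m. distr M borel (Y m) = centered_normal (v m)"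
    and v: "\<And>m. v m \<ge> 0" "v \<longlonglongrightarrow> w"
  shows "distr M borel X = centered_normal w"
proof (rule Levy_uniqueness)
  have w: "w \<ge> 0" by (rule LIMSEQ_le_const[OF v(2)]) (use v(1) in auto)
  show "real_distribution (distr M borel X)" by simp
  show "real_distribution (centered_normal w)" by (rule real_distribution_centered_normal[OF w])
  show "char (distr M borel X) = char (centered_normal w)"
  proof
    fix t :: real
    have char_distr: "char (distr M borel Z) t = (CLINT \<omega>|M. iexp (t * Z \<omega>))"
      if [measurable]: "Z \<in> borel_measurable M" for Z
      unfolding char_def by (subst integral_distr) auto
    have int: "integrable M (\<lambda>\<omega>. iexp (t * Z \<omega>))" if [measurable]: "Z \<in> borel_measurable M" for Z
      by (rule integrable_const_bound[of _ 1]) auto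
    have "(\<lambda>m. char (distr M borel (Y m)) t) \<longlonglongrightarrow> char (distr M borel X) t"
    proof (rule LIMSEQ_I)
      fix r :: real assume r: "0 < r"
      define e where "e = r / 4"
      have e: "e > 0" using r by (simp add: e_def)
      \<comment> \<open>The first power of the difference is traded for its square, which is what
        the hypothesis controls. Both terms end up at most \<open>e\<close>, and
        \<open>2 * e = r / 2\<close>.\<close>
      have pointwise: "norm (iexp (t * X \<omega>) - iexp (t * Y m \<omega>))
          \<le> e + t\<^sup>2 / e * (X \<omega> - Y m \<omega>)\<^sup>2" for m \<omega>
      proof -
        have "iexp (t * X \<omega>) - iexp (t * Y m \<omega>)
            = iexp (t * Y m \<omega>) * (iexp (t * X \<omega> - t * Y m \<omega>) - 1)"
          by (simp add: algebra_simps flip: exp_add)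
        then have "norm (iexp (t * X \<omega>) - iexp (t * Y m \<omega>)) = norm (iexp (t * X \<omega> - t * Y m \<omega>) - 1)"
          by (simp add: norm_mult)
        also have "\<dots> \<le> \<bar>t * X \<omega> - t * Y m \<omega>\<bar>"
          using iexp_approx1[of "t * X \<omega> - t * Y m \<omega>" 0] by simp
        also have "\<dots> \<le> e + \<bar>t * X \<omega> - t * Y m \<omega>\<bar>\<^sup>2 / e"
        proof -
          define a where "a = \<bar>t * X \<omega> - t * Y m \<omega>\<bar>"
          have "0 \<le> (a - e)\<^sup>2 + a * e" using e by (simp add: a_def)
          then have "a * e \<le> e\<^sup>2 + a\<^sup>2" by (simp add: power2_eq_square algebra_simps)
          then show ?thesis using e unfolding a_def[symmetric]
            by (simp add: field_simps power2_eq_square)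
        qed
        also have "\<bar>t * X \<omega> - t * Y m \<omega>\<bar>\<^sup>2 / e = t\<^sup>2 / e * (X \<omega> - Y m \<omega>)\<^sup>2"
        proof -
          have "t * X \<omega> - t * Y m \<omega> = t * (X \<omega> - Y m \<omega>)" by (simp add: algebra_simps)
          then show ?thesis by (simp only: power2_abs power_mult_distrib times_divide_eq_left)
        qed
        finally show ?thesis .
      qed
      have "(\<lambda>m. ennreal (t\<^sup>2 / e) * (\<integral>\<^sup>+\<omega>. ennreal ((X \<omega> - Y m \<omega>)\<^sup>2) \<partial>M)) \<longlonglongrightarrow> ennreal (t\<^sup>2 / e) * 0"
        by (intro ennreal_tendsto_cmult L2) simp
      then have "\<forall>\<^sub>F m in sequentially. ennreal (t\<^sup>2 / e) * (\<integral>\<^sup>+\<omega>. ennreal ((X \<omega> - Y m \<omega>)\<^sup>2) \<partial>M) < ennreal e"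
        using e by (intro order_tendstoD) auto
      then obtain N where N: "\<And>m. m \<ge> N \<Longrightarrow>
          ennreal (t\<^sup>2 / e) * (\<integral>\<^sup>+\<omega>. ennreal ((X \<omega> - Y m \<omega>)\<^sup>2) \<partial>M) < ennreal e"
        unfolding eventually_sequentially by blast
      have "norm (char (distr M borel (Y m)) t - char (distr M borel X) t) < r" if "m \<ge> N" for m
      proof -
        have "char (distr M borel (Y m)) t - char (distr M borel X) t
            = - (CLINT \<omega>|M. iexp (t * X \<omega>) - iexp (t * Y m \<omega>))"
          unfolding char_distr[OF assms(1)] char_distr[OF assms(2)]
          by (subst Bochner_Integration.integral_diff) (rule int assms | simp)+
        then have "norm (char (distr M borel (Y m)) t - char (distr M borel X) t)
            = norm (CLINT \<omega>|M. iexp (t * X \<omega>) - iexp (t * Y m \<omega>))" by simp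
        also have "ennreal \<dots> \<le> (\<integral>\<^sup>+\<omega>. ennreal (norm (iexp (t * X \<omega>) - iexp (t * Y m \<omega>))) \<partial>M)"
          by (intro integral_norm_bound_ennreal Bochner_Integration.integrable_diff int) auto
        also have "\<dots> \<le> (\<integral>\<^sup>+\<omega>. ennreal e + ennreal (t\<^sup>2 / e) * ennreal ((X \<omega> - Y m \<omega>)\<^sup>2) \<partial>M)"
          using e by (intro nn_integral_mono order_trans[OF ennreal_leI[OF pointwise]])
            (simp flip: ennreal_mult' ennreal_plus)
        also have "\<dots> = ennreal e + ennreal (t\<^sup>2 / e) * (\<integral>\<^sup>+\<omega>. ennreal ((X \<omega> - Y m \<omega>)\<^sup>2) \<partial>M)"
          by (simp add: nn_integral_add nn_integral_cmult emeasure_space_1)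
        also have "\<dots> \<le> ennreal e + ennreal e"
          by (intro add_left_mono less_imp_le N that)
        also have "\<dots> = ennreal (2 * e)" using e by (simp flip: ennreal_plus)
        finally show ?thesis using e unfolding e_def by simp
      qed
      then show "\<exists>N. \<forall>m\<ge>N. norm (char (distr M borel (Y m)) t - char (distr M borel X) t) < r"
        by blast
    qed
    moreover have "(\<lambda>m. char (distr M borel (Y m)) t) \<longlonglongrightarrow> char (centered_normal w) t"
      unfolding normal char_centered_normal[OF v(1)] char_centered_normal[OF w]
      by (intro tendsto_of_real tendsto_intros v(2)) simp
    ultimately show "char (distr M borel X) t = char (centered_normal w) t"
      by (rule LIMSEQ_unique)
  qed
qed

section \<open>The Gaussian shift model\<close>

text \<open>The sample size is fixed here: all estimates in this locale and its extensions are
  non-asymptotic.\<close>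

locale gaussian_model = covariance \<zeta> + onb b
  for \<zeta> :: "'b::{real_inner, polish_space} \<Rightarrow> 'b" and b :: "nat \<Rightarrow> 'b" +
  fixes G :: "'a::{real_inner, polish_space} \<Rightarrow> 'b"
    and P :: "'o measure"
    and \<eta> :: "'o \<Rightarrow> nat \<Rightarrow> real"
    and n :: nat
    and L :: "(nat \<Rightarrow> real) \<Rightarrow> 'b \<Rightarrow> real"
  assumes bounded_linear_G: "bounded_linear G"
    and range_G: "range G \<subseteq> cm_space \<zeta>"
    and noise: "gaussian_noise P \<zeta> b \<eta>"
    and n_ge_1: "n \<ge> 1"
    and pairing: "cm_functional \<zeta> b (data_law P b \<eta> G n 0) L"
begin

abbreviation \<gamma> :: "(nat \<Rightarrow> real) measure" where
  "\<gamma> \<equiv> data_law P b \<eta> G n 0"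

text \<open>In these coordinates the Cameron-Martin inner product becomes the ordinary one.\<close>

definition whitened :: "'a \<Rightarrow> 'b" where
  "whitened u = inv (op_sqrt \<zeta>) (G u)"

sublocale G: bounded_linear G by (rule bounded_linear_G)

sublocale P: prob_space P
  using noise by (simp add: gaussian_noise_def)

lemma eta_measurable [measurable]: "\<eta> \<in> measurable P data_space"
  using noise by (simp add: gaussian_noise_def)

lemma eta_component_measurable [measurable]: "(\<lambda>\<omega>. \<eta> \<omega> i) \<in> borel_measurable P"
  using measurable_compose[OF eta_measurable measurable_component_singleton[of i UNIV]] by simp

lemma n_pos: "real n > 0"
  using n_ge_1 by simp

lemma root_whitened: "op_sqrt \<zeta> (whitened u) = G u"
proof -
  have "G u \<in> range (op_sqrt \<zeta>)" using range_G by (auto simp: cm_space_def)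
  then show ?thesis unfolding whitened_def by (rule f_inv_into_f)
qed

lemma cm_norm_G: "cm_norm \<zeta> (G u) = norm (whitened u)"
  by (simp add: cm_norm_def whitened_def)

lemma whitened_diff: "whitened (u - v) = whitened u - whitened v"
  by (rule injD[OF inj_root]) (simp add: root.diff root_whitened G.diff)

lemma sets_data_law [measurable_cong]: "sets (data_law P b \<eta> G n v) = sets data_space"
  by (simp add: data_law_def)

lemma space_data_law: "space (data_law P b \<eta> G n v) = UNIV"
  by (simp add: data_law_def space_PiM)

lemma data_law_map_measurable [measurable]:
  "(\<lambda>\<omega> i. c i + \<eta> \<omega> i / sqrt (real n)) \<in> measurable P data_space"
  by (rule measurable_PiM_single') (auto simp: space_PiM)

lemma prob_data_law: "prob_space (data_law P b \<eta> G n v)"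
  unfolding data_law_def by (rule P.prob_space_distr, rule data_law_map_measurable)

sublocale \<gamma>: prob_space \<gamma> by (rule prob_data_law)

lemma data_law_shift: "data_law P b \<eta> G n v = distr \<gamma> data_space (\<lambda>y i. G v \<bullet> b i + y i)"
proof -
  have [measurable]: "(\<lambda>y i. G v \<bullet> b i + y i) \<in> measurable data_space data_space"
    by (rule measurable_PiM_single') (auto simp: space_PiM)
  show ?thesis
    unfolding data_law_def
    by (subst distr_distr[OF _ data_law_map_measurable]) (auto simp: comp_def G.zero)
qed

section \<open>Coordinate pairings and their L2 limits\<close>

lemma coord_pairing_sum:
  assumes "finite J" "x = (\<Sum>i\<in>J. (x \<bullet> b i) *\<^sub>R b i)"
  shows "coord_pairing b y x = (\<Sum>i\<in>J. (x \<bullet> b i) * y i)"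
proof -
  have "x \<bullet> b i = 0" if "i \<notin> J" for i
    by (subst assms(2)) (use that assms(1) in \<open>simp add: inner_sum_basis\<close>)
  then show ?thesis
    unfolding coord_pairing_def using assms(1) by (intro sum.mono_neutral_left) auto
qed

lemma coord_pairing_add_scale:
  assumes "x \<in> span (range b)" "x' \<in> span (range b)"
  shows "coord_pairing b y (r *\<^sub>R x + x') = r * coord_pairing b y x + coord_pairing b y x'"
proof -
  obtain J where J: "finite J" "x = (\<Sum>i\<in>J. (x \<bullet> b i) *\<^sub>R b i)"
    using span_range_repr[OF assms(1)] by blast
  obtain J' where J': "finite J'" "x' = (\<Sum>i\<in>J'. (x' \<bullet> b i) *\<^sub>R b i)"
    using span_range_repr[OF assms(2)] by blast
  have rep: "z = (\<Sum>i\<in>J \<union> J'. (z \<bullet> b i) *\<^sub>R b i)" if "z \<in> span (b ` (J \<union> J'))" for z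
    using span_repr[OF _ that] J(1) J'(1) by simp
  have xx': "x \<in> span (b ` (J \<union> J'))" "x' \<in> span (b ` (J \<union> J'))"
    by (subst J J', intro span_sum span_scale span_base, auto)+
  then have "r *\<^sub>R x + x' \<in> span (b ` (J \<union> J'))" by (intro span_add span_scale)
  from coord_pairing_sum[OF _ rep[OF this], of y] coord_pairing_sum[OF _ rep[OF xx'(1)], of y]
    coord_pairing_sum[OF _ rep[OF xx'(2)], of y] J(1) J'(1)
  show ?thesis
    by (simp add: inner_add_left sum_distrib_left sum.distrib distrib_right mult.assoc)
qed

lemma coord_pairing_measurable:
  assumes "x \<in> span (range b)"
  shows "(\<lambda>y. coord_pairing b y x) \<in> borel_measurable data_space"
proof -
  obtain J where "finite J" "x = (\<Sum>i\<in>J. (x \<bullet> b i) *\<^sub>R b i)"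
    using span_range_repr[OF assms] by blast
  then show ?thesis by (simp add: coord_pairing_sum[of J x])
qed

lemma coord_pairing_law:
  assumes "x \<in> span (range b)"
  shows "distr \<gamma> borel (\<lambda>y. coord_pairing b y x) = centered_normal ((norm (op_sqrt \<zeta> x))\<^sup>2 / real n)"
proof -
  note [measurable] = coord_pairing_measurable[OF assms]
  obtain J where J: "finite J" "x = (\<Sum>i\<in>J. (x \<bullet> b i) *\<^sub>R b i)"
    using span_range_repr[OF assms] by blast
  define c where "c i = x \<bullet> b i / sqrt (real n)" for i
  have "distr \<gamma> borel (\<lambda>y. coord_pairing b y x) = distr P borel (\<lambda>\<omega>. \<Sum>i\<in>J. c i * \<eta> \<omega> i)"
    unfolding data_law_def coord_pairing_sum[OF J]
    by (subst distr_distr[OF _ data_law_map_measurable])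
      (auto simp: comp_def c_def G.zero intro!: distr_cong sum.cong)
  also have "\<dots> = centered_normal (\<Sum>i\<in>J. \<Sum>j\<in>J. c i * c j * (\<zeta> (b i) \<bullet> b j))"
    using noise J(1) by (simp add: gaussian_noise_def)
  also have "(\<Sum>i\<in>J. \<Sum>j\<in>J. c i * c j * (\<zeta> (b i) \<bullet> b j)) = (norm (op_sqrt \<zeta> x))\<^sup>2 / real n"
  proof -
    have "(norm (op_sqrt \<zeta> x))\<^sup>2 = (\<Sum>i\<in>J. \<Sum>j\<in>J. (x \<bullet> b i) * (x \<bullet> b j) * (\<zeta> (b i) \<bullet> b j))"
      unfolding power2_norm_eq_inner cov_inner
      by (subst (1 2) J(2)) (simp add: root.sum root.scale inner_sum_left inner_sum_right
          sum_distrib_left inner_commute mult_ac)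
    then show ?thesis
      using n_pos by (simp add: c_def sum_divide_distrib)
  qed
  finally show ?thesis .
qed

text \<open>\<open>gauss X z\<close>: the random variable \<open>X\<close> is the value at \<open>z\<close> of the map into \<open>L\<^sup>2(\<gamma>)\<close> that
  extends \<open>\<zeta>\<^sup>1\<^sup>/\<^sup>2 x \<mapsto> \<langle>y, x\<rangle>\<close>; up to the factor \<open>1 / sqrt n\<close> it is an isometry.\<close>

definition gauss :: "((nat \<Rightarrow> real) \<Rightarrow> real) \<Rightarrow> 'b \<Rightarrow> bool" where
  "gauss X z \<longleftrightarrow> X \<in> borel_measurable data_space \<and>
     (\<exists>x. (\<forall>m. x m \<in> span (range b)) \<and> (\<lambda>m. op_sqrt \<zeta> (x m)) \<longlonglongrightarrow> z \<and>
       (\<lambda>m. \<integral>\<^sup>+y. ennreal ((X y - coord_pairing b y (x m))\<^sup>2) \<partial>\<gamma>) \<longlonglongrightarrow> 0)"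

lemma gauss_measurable: "gauss X z \<Longrightarrow> X \<in> borel_measurable data_space"
  by (simp add: gauss_def)

lemma gauss_law:
  assumes "gauss X z"
  shows "distr \<gamma> borel X = centered_normal ((norm z)\<^sup>2 / real n)"
proof -
  obtain x where x: "\<And>m. x m \<in> span (range b)" "(\<lambda>m. op_sqrt \<zeta> (x m)) \<longlonglongrightarrow> z"
    "(\<lambda>m. \<integral>\<^sup>+y. ennreal ((X y - coord_pairing b y (x m))\<^sup>2) \<partial>\<gamma>) \<longlonglongrightarrow> 0"
    using assms unfolding gauss_def by blast
  note [measurable] = gauss_measurable[OF assms] coord_pairing_measurable[OF x(1)]
  show ?thesis
  proof (rule \<gamma>.distr_L2_limit_normal[OF _ _ x(3)])
    show "(\<lambda>m. (norm (op_sqrt \<zeta> (x m)))\<^sup>2 / real n) \<longlonglongrightarrow> (norm z)\<^sup>2 / real n"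
      using n_pos by (intro tendsto_intros x) simp
  qed (auto simp: coord_pairing_law x(1))
qed

lemma gauss_mgf:
  assumes "gauss X z"
  shows "(\<integral>\<^sup>+y. ennreal (exp (X y)) \<partial>\<gamma>) = ennreal (exp ((norm z)\<^sup>2 / (2 * real n)))"
proof -
  note [measurable] = gauss_measurable[OF assms]
  have "(\<integral>\<^sup>+y. ennreal (exp (X y)) \<partial>\<gamma>) = (\<integral>\<^sup>+x. ennreal (exp (1 * x)) \<partial>distr \<gamma> borel X)"
    by (subst nn_integral_distr) auto
  also have "\<dots> = ennreal (exp ((norm z)\<^sup>2 / (2 * real n)))"
    unfolding gauss_law[OF assms] by (subst centered_normal_mgf) (auto simp: field_simps)
  finally show ?thesis .
qed

text \<open>This stands in for almost sure linearity of \<open>L\<close>: the approximating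
  sequences are combined, and the errors by
  \<open>(r s + t)^2 \<le> 2 r^2 s^2 + 2 t^2\<close>.\<close>

lemma gauss_add_scale:
  assumes "gauss X z" "gauss X' z'"
  shows "gauss (\<lambda>y. r * X y + X' y) (r *\<^sub>R z + z')"
proof -
  note [measurable] = assms[THEN gauss_measurable]
  obtain x where x: "\<And>m. x m \<in> span (range b)" "(\<lambda>m. op_sqrt \<zeta> (x m)) \<longlonglongrightarrow> z"
    "(\<lambda>m. \<integral>\<^sup>+y. ennreal ((X y - coord_pairing b y (x m))\<^sup>2) \<partial>\<gamma>) \<longlonglongrightarrow> 0"
    using assms(1) unfolding gauss_def by blast
  obtain x' where x': "\<And>m. x' m \<in> span (range b)" "(\<lambda>m. op_sqrt \<zeta> (x' m)) \<longlonglongrightarrow> z'"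
    "(\<lambda>m. \<integral>\<^sup>+y. ennreal ((X' y - coord_pairing b y (x' m))\<^sup>2) \<partial>\<gamma>) \<longlonglongrightarrow> 0"
    using assms(2) unfolding gauss_def by blast
  note [measurable] = coord_pairing_measurable[OF x(1)] coord_pairing_measurable[OF x'(1)]
  have le: "((r * X y + X' y) - coord_pairing b y (r *\<^sub>R x m + x' m))\<^sup>2
      \<le> 2 * r\<^sup>2 * (X y - coord_pairing b y (x m))\<^sup>2 + 2 * (X' y - coord_pairing b y (x' m))\<^sup>2" for y m
  proof -
    define s t where "s = X y - coord_pairing b y (x m)" and "t = X' y - coord_pairing b y (x' m)"
    have "(r * X y + X' y) - coord_pairing b y (r *\<^sub>R x m + x' m) = r * s + t"
      unfolding s_def t_def coord_pairing_add_scale[OF x(1) x'(1)] by (simp add: algebra_simps)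
    moreover have "0 \<le> (r * s - t)\<^sup>2" by simp
    ultimately show ?thesis
      unfolding s_def[symmetric] t_def[symmetric] by (simp add: power2_eq_square algebra_simps)
  qed
  have lim: "(\<lambda>m. \<integral>\<^sup>+y. ennreal (((r * X y + X' y) - coord_pairing b y (r *\<^sub>R x m + x' m))\<^sup>2) \<partial>\<gamma>) \<longlonglongrightarrow> 0"
  proof (rule tendsto_sandwich[OF _ _ tendsto_const])
    let ?U = "\<lambda>m. ennreal (2 * r\<^sup>2) * (\<integral>\<^sup>+y. ennreal ((X y - coord_pairing b y (x m))\<^sup>2) \<partial>\<gamma>)
        + ennreal 2 * (\<integral>\<^sup>+y. ennreal ((X' y - coord_pairing b y (x' m))\<^sup>2) \<partial>\<gamma>)"
    have "?U \<longlonglongrightarrow> ennreal (2 * r\<^sup>2) * 0 + ennreal 2 * 0"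
      by (intro tendsto_add ennreal_tendsto_cmult x(3) x'(3)) auto
    then show "?U \<longlonglongrightarrow> 0" by simp
    have "(\<integral>\<^sup>+y. ennreal (((r * X y + X' y) - coord_pairing b y (r *\<^sub>R x m + x' m))\<^sup>2) \<partial>\<gamma>) \<le> ?U m" for m
    proof -
      have "(\<integral>\<^sup>+y. ennreal (((r * X y + X' y) - coord_pairing b y (r *\<^sub>R x m + x' m))\<^sup>2) \<partial>\<gamma>)
          \<le> (\<integral>\<^sup>+y. ennreal (2 * r\<^sup>2) * ennreal ((X y - coord_pairing b y (x m))\<^sup>2)
            + ennreal 2 * ennreal ((X' y - coord_pairing b y (x' m))\<^sup>2) \<partial>\<gamma>)"
        by (intro nn_integral_mono order_trans[OF ennreal_leI[OF le]])
          (simp add: ennreal_plus ennreal_mult')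
      also have "\<dots> = ?U m" by (simp add: nn_integral_add nn_integral_cmult)
      finally show ?thesis .
    qed
    then show "\<forall>\<^sub>F m in sequentially. (\<integral>\<^sup>+y. ennreal (((r * X y + X' y)
        - coord_pairing b y (r *\<^sub>R x m + x' m))\<^sup>2) \<partial>\<gamma>) \<le> ?U m" by simp
  qed simp
  show ?thesis
    unfolding gauss_def
  proof (intro conjI exI[of _ "\<lambda>m. r *\<^sub>R x m + x' m"])
    show "(\<lambda>m. op_sqrt \<zeta> (r *\<^sub>R x m + x' m)) \<longlonglongrightarrow> r *\<^sub>R z + z'"
      unfolding root.add root.scale by (intro tendsto_intros x x')
  qed (use lim in \<open>auto intro!: span_add span_scale x x'\<close>)
qed

lemma gauss_0: "gauss (\<lambda>y. 0) 0"
  unfolding gauss_def by (auto intro!: exI[of _ "\<lambda>_. 0"] simp: span_zero root.zero coord_pairing_def)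

lemma gauss_scale: "gauss X z \<Longrightarrow> gauss (\<lambda>y. r * X y) (r *\<^sub>R z)"
  using gauss_add_scale[OF _ gauss_0, of X z r] by simp

lemma gauss_sum:
  assumes "\<And>i. i \<in> J \<Longrightarrow> gauss (X i) (z i)"
  shows "gauss (\<lambda>y. \<Sum>i\<in>J. c i * X i y) (\<Sum>i\<in>J. c i *\<^sub>R z i)"
proof (cases "finite J")
  case True
  then show ?thesis using assms
    by (induction J) (auto intro!: gauss_0 gauss_add_scale)
qed (simp add: gauss_0)

lemma gauss_coord: "gauss (\<lambda>y. y i) (op_sqrt \<zeta> (b i))"
proof -
  have "coord_pairing b y (b i) = y i" for y
    using coord_pairing_sum[of "{i}" "b i" y] by (simp add: inner_basis)
  then show ?thesis
    unfolding gauss_def by (auto intro!: exI[of _ "\<lambda>_. b i"] span_base)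
qed

text \<open>\<open>cm_functional\<close> constrains \<open>L\<close> at a point only through
  approximation by vectors of the span; density guarantees that every point has such an
  approximation.\<close>

lemma root_span_dense: "closure (op_sqrt \<zeta> ` span (range b)) = UNIV"
proof -
  have "range (op_sqrt \<zeta>) \<subseteq> closure (op_sqrt \<zeta> ` span (range b))"
    unfolding dense[symmetric]
    by (intro image_closure_subset root.continuous_on continuous_on_id) (auto simp: closure_subset)
  then have "closure (range (op_sqrt \<zeta>)) \<subseteq> closure (op_sqrt \<zeta> ` span (range b))"
    by (rule closure_minimal) simp
  then show ?thesis using range_root_dense by auto
qed

lemma L_measurable: "(\<lambda>(y, h). L y h) \<in> borel_measurable (data_space \<Otimes>\<^sub>M borel)"
  using pairing by (simp add: cm_functional_def)

text \<open>Convergence of \<open>\<zeta> (x m)\<close> to \<open>op_sqrt \<zeta> z\<close> in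
  Cameron-Martin norm is the same as convergence of \<open>op_sqrt \<zeta> (x m)\<close> to
  \<open>z\<close>.\<close>

lemma gauss_L: "gauss (\<lambda>y. L y (op_sqrt \<zeta> z)) z"
proof -
  have "z \<in> closure (op_sqrt \<zeta> ` span (range b))" by (simp add: root_span_dense)
  then obtain w where w: "\<And>m. w m \<in> op_sqrt \<zeta> ` span (range b)" "w \<longlonglongrightarrow> z"
    unfolding closure_sequential by blast
  then have "\<forall>m. \<exists>x. x \<in> span (range b) \<and> w m = op_sqrt \<zeta> x" by blast
  then obtain x where x: "\<And>m. x m \<in> span (range b)" "\<And>m. w m = op_sqrt \<zeta> (x m)" by metis
  have "(\<lambda>m. norm (w m - z)) \<longlonglongrightarrow> 0"
    using tendsto_norm[OF tendsto_diff[OF w(2) tendsto_const[of z]]] by simp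
  then have "(\<lambda>m. cm_norm \<zeta> (\<zeta> (x m) - op_sqrt \<zeta> z)) \<longlonglongrightarrow> 0"
    by (simp add: x(2) cm_norm_root flip: root_root root.diff)
  moreover have "op_sqrt \<zeta> z \<in> cm_space \<zeta>" by (simp add: cm_space_def)
  ultimately have "(\<lambda>m. \<integral>\<^sup>+y. ennreal ((L y (op_sqrt \<zeta> z) - coord_pairing b y (x m))\<^sup>2) \<partial>\<gamma>) \<longlonglongrightarrow> 0"
    using pairing x(1) unfolding cm_functional_def by blast
  moreover have "(\<lambda>y. L y (op_sqrt \<zeta> z)) \<in> borel_measurable data_space"
    using measurable_compose[OF _ L_measurable, of "\<lambda>y. (y, op_sqrt \<zeta> z)" data_space] by simp
  ultimately show ?thesis
    unfolding gauss_def using x(1) w(2)[unfolded x(2)[abs_def]] by blast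
qed

lemma gauss_L_G: "gauss (\<lambda>y. L y (G u)) (whitened u)"
  using gauss_L[of "whitened u"] by (simp add: root_whitened)

section \<open>The likelihood and the Cameron-Martin theorem\<close>

definition likelihood :: "'a \<Rightarrow> (nat \<Rightarrow> real) \<Rightarrow> real" where
  "likelihood u y = exp (- potential \<zeta> G L n y u)"

lemma likelihood_eq: "likelihood u y = exp (real n * L y (G u) - real n / 2 * (norm (whitened u))\<^sup>2)"
  by (simp add: likelihood_def potential_def cm_norm_G)

lemma likelihood_pos: "0 < likelihood u y"
  by (simp add: likelihood_def)

text \<open>Completing the square: the tilt keeps the variance and adds the mean
  \<open>z \<bullet> whitened u\<close>. This one formula gives the mass of the tilted measure, its
  Laplace transform, the error of the estimator and the moment of the likelihood ratio.\<close>

lemma tilted_mgf: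
  assumes "gauss X z"
  shows "(\<integral>\<^sup>+y. ennreal (exp (X y) * likelihood u y) \<partial>\<gamma>)
      = ennreal (exp (z \<bullet> whitened u + (norm z)\<^sup>2 / (2 * real n)))"
proof -
  define t where "t = real n / 2 * (norm (whitened u))\<^sup>2"
  have g: "gauss (\<lambda>y. real n * L y (G u) + X y) (real n *\<^sub>R whitened u + z)"
    by (intro gauss_add_scale gauss_L_G assms)
  note [measurable] = gauss_measurable[OF g]
  have "(\<integral>\<^sup>+y. ennreal (exp (X y) * likelihood u y) \<partial>\<gamma>)
      = (\<integral>\<^sup>+y. ennreal (exp (- t)) * ennreal (exp (real n * L y (G u) + X y)) \<partial>\<gamma>)"
    by (intro nn_integral_cong)
      (simp add: likelihood_eq t_def mult_ac flip: ennreal_mult' exp_add)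
  also have "\<dots> = ennreal (exp (- t)) * ennreal (exp ((norm (real n *\<^sub>R whitened u + z))\<^sup>2 / (2 * real n)))"
    by (simp add: nn_integral_cmult gauss_mgf[OF g])
  also have "\<dots> = ennreal (exp ((norm (real n *\<^sub>R whitened u + z))\<^sup>2 / (2 * real n) - t))"
    by (simp add: add.commute flip: ennreal_mult' exp_add)
  also have "(norm (real n *\<^sub>R whitened u + z))\<^sup>2 / (2 * real n) - t
      = z \<bullet> whitened u + (norm z)\<^sup>2 / (2 * real n)"
  proof -
    have "(norm (real n *\<^sub>R whitened u + z))\<^sup>2
        = (real n)\<^sup>2 * (norm (whitened u))\<^sup>2 + 2 * real n * (z \<bullet> whitened u) + (norm z)\<^sup>2"
      unfolding power2_norm_eq_inner
      by (simp add: inner_add_left inner_add_right inner_commute power2_eq_square algebra_simps)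
    then show ?thesis using n_pos unfolding t_def by (simp add: field_simps power2_eq_square)
  qed
  finally show ?thesis .
qed

lemma likelihood_measurable [measurable]: "likelihood u \<in> borel_measurable data_space"
proof -
  note [measurable] = gauss_measurable[OF gauss_L_G[of u]]
  show ?thesis unfolding likelihood_eq[abs_def] by measurable
qed

text \<open>Both Laplace transforms at \<open>x = (\<Sum>i\<in>J. c i *\<^sub>R b i)\<close> come
  out as the same exponential: on the left \<open>G v\<close> enters through the shift of the data,
  on the right through the tilt.\<close>

theorem Cameron_Martin_density: "data_law P b \<eta> G n v = density \<gamma> (likelihood v)"
proof (rule laplace_unique_PiM)
  note [measurable_cong] = sets_data_law
  interpret Q: prob_space "data_law P b \<eta> G n v" by (rule prob_data_law)
  show "finite_measure (data_law P b \<eta> G n v)" by unfold_locales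
  show sets: "sets (data_law P b \<eta> G n v) = sets data_space"
    "sets (density \<gamma> (likelihood v)) = sets data_space"
    by (simp_all add: sets_data_law)
  show "finite_measure (density \<gamma> (likelihood v))"
  proof (rule finite_measureI)
    have "emeasure (density \<gamma> (likelihood v)) (space (density \<gamma> (likelihood v)))
        = (\<integral>\<^sup>+y. ennreal (exp 0 * likelihood v y) \<partial>\<gamma>)"
      by (simp add: emeasure_density cong: nn_integral_cong)
    then show "emeasure (density \<gamma> (likelihood v)) (space (density \<gamma> (likelihood v))) \<noteq> \<infinity>"
      using tilted_mgf[OF gauss_0, of v] by simp
  qed
  fix J :: "nat set" and c :: "nat \<Rightarrow> real" assume J: "finite J"
  define x where "x = (\<Sum>i\<in>J. c i *\<^sub>R b i)"
  have g: "gauss (\<lambda>y. \<Sum>i\<in>J. c i * y i) (op_sqrt \<zeta> x)"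
    unfolding x_def root.sum root.scale by (intro gauss_sum gauss_coord)
  note [measurable] = gauss_measurable[OF g]
  have 1: "(\<integral>\<^sup>+y. ennreal (exp (\<Sum>i\<in>J. c i * y i)) \<partial>data_law P b \<eta> G n v)
      = ennreal (exp (x \<bullet> G v + (norm (op_sqrt \<zeta> x))\<^sup>2 / (2 * real n)))"
  proof -
    have [measurable]: "(\<lambda>y i. G v \<bullet> b i + y i) \<in> measurable data_space data_space"
      by (rule measurable_PiM_single') (auto simp: space_PiM)
    have "(\<integral>\<^sup>+y. ennreal (exp (\<Sum>i\<in>J. c i * y i)) \<partial>data_law P b \<eta> G n v)
        = (\<integral>\<^sup>+y. ennreal (exp (\<Sum>i\<in>J. c i * (G v \<bullet> b i + y i))) \<partial>\<gamma>)"
      unfolding data_law_shift[of v] by (subst nn_integral_distr) auto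
    also have "\<dots> = (\<integral>\<^sup>+y. ennreal (exp (x \<bullet> G v)) * ennreal (exp (\<Sum>i\<in>J. c i * y i)) \<partial>\<gamma>)"
      by (intro nn_integral_cong)
        (simp add: x_def inner_sum_left inner_commute[of "G v"] distrib_left sum.distrib
          flip: ennreal_mult' exp_add)
    also have "\<dots> = ennreal (exp (x \<bullet> G v)) * ennreal (exp ((norm (op_sqrt \<zeta> x))\<^sup>2 / (2 * real n)))"
      by (simp add: nn_integral_cmult gauss_mgf[OF g])
    finally show ?thesis by (simp flip: ennreal_mult' exp_add)
  qed
  have 2: "(\<integral>\<^sup>+y. ennreal (exp (\<Sum>i\<in>J. c i * y i)) \<partial>density \<gamma> (likelihood v))
      = ennreal (exp (x \<bullet> G v + (norm (op_sqrt \<zeta> x))\<^sup>2 / (2 * real n)))"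
  proof -
    have "(\<integral>\<^sup>+y. ennreal (exp (\<Sum>i\<in>J. c i * y i)) \<partial>density \<gamma> (likelihood v))
        = (\<integral>\<^sup>+y. ennreal (exp (\<Sum>i\<in>J. c i * y i) * likelihood v y) \<partial>\<gamma>)"
      using likelihood_pos
      by (subst nn_integral_density) (auto intro!: nn_integral_cong simp: mult.commute less_imp_le simp flip: ennreal_mult)
    then show ?thesis
      by (simp add: tilted_mgf[OF g] root_inner root_whitened)
  qed
  show "(\<integral>\<^sup>+y. ennreal (exp (\<Sum>i\<in>J. c i * y i)) \<partial>data_law P b \<eta> G n v)
      = (\<integral>\<^sup>+y. ennreal (exp (\<Sum>i\<in>J. c i * y i)) \<partial>density \<gamma> (likelihood v))"
    using 1 2 by simp
  show "(\<integral>\<^sup>+y. ennreal (exp (\<Sum>i\<in>J. c i * y i)) \<partial>data_law P b \<eta> G n v) < \<infinity>"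
    using 1 by simp
qed

end

section \<open>Concentration of the linear estimator\<close>

text \<open>The factor turns the standard density into a multiple of the density of variance
  2.\<close>

lemma std_normal_exp_square:
  "(\<integral>\<^sup>+x. ennreal (exp (x\<^sup>2 / 4)) \<partial>std_normal_distribution) = ennreal (sqrt 2)"
proof -
  have eq: "std_normal_density x * exp (x\<^sup>2 / 4) = sqrt 2 * normal_density 0 (sqrt 2) x" for x
  proof -
    have "exp (- x\<^sup>2 / 2) * exp (x\<^sup>2 / 4) = exp (- x\<^sup>2 / 4)"
      unfolding exp_add[symmetric] by (simp add: field_simps)
    moreover have "sqrt (2 * pi * 2) = sqrt 2 * sqrt (2 * pi)"
      by (simp only: real_sqrt_mult[symmetric] mult_ac)
    ultimately show ?thesis by (simp add: normal_density_def field_simps)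
  qed
  interpret N: prob_space "density lborel (normal_density 0 (sqrt 2))"
    by (rule prob_space_normal_density) simp
  have one: "(\<integral>\<^sup>+x. ennreal (normal_density 0 (sqrt 2) x) \<partial>lborel) = 1"
    using N.emeasure_space_1 by (simp add: emeasure_density)
  have "(\<integral>\<^sup>+x. ennreal (exp (x\<^sup>2 / 4)) \<partial>std_normal_distribution)
      = (\<integral>\<^sup>+x. ennreal (sqrt 2) * ennreal (normal_density 0 (sqrt 2) x) \<partial>lborel)"
    by (subst nn_integral_density) (auto intro!: nn_integral_cong simp: eq simp flip: ennreal_mult')
  also have "\<dots> = ennreal (sqrt 2)"
    by (subst nn_integral_cmult) (auto simp: one)
  finally show ?thesis .
qed

text \<open>Each factor \<open>exp (Z\<^sup>2 / (4 s))\<close> is replaced by the average of \<open>exp (\<xi> Z / sqrt (2 s))\<close> over a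
  standard normal \<open>\<xi>\<close>, one coordinate at a time.\<close>

lemma (in prob_space) subgaussian_square_mgf:
  fixes Z :: "nat \<Rightarrow> 'a \<Rightarrow> real"
  assumes [measurable]: "\<And>j. Z j \<in> borel_measurable M"
    and s: "s > 0"
    and mgf: "\<And>c. (\<integral>\<^sup>+\<omega>. ennreal (exp (\<Sum>j<k. c j * Z j \<omega>)) \<partial>M) \<le> ennreal (exp (s / 2 * (\<Sum>j<k. (c j)\<^sup>2)))"
  shows "(\<integral>\<^sup>+\<omega>. ennreal (exp ((\<Sum>j<k. (Z j \<omega>)\<^sup>2) / (4 * s))) \<partial>M) \<le> ennreal (sqrt 2 ^ k)"
proof -
  interpret N: prob_space std_normal_distribution by (rule std_normal_prob)
  interpret MN: pair_sigma_finite M std_normal_distribution ..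
  have "(\<integral>\<^sup>+\<omega>. ennreal (exp ((\<Sum>j<m. (Z j \<omega>)\<^sup>2) / (4 * s) + (\<Sum>j=m..<k. c j * Z j \<omega>))) \<partial>M)
      \<le> ennreal (sqrt 2 ^ m * exp (s / 2 * (\<Sum>j=m..<k. (c j)\<^sup>2)))" if "m \<le> k" for m c
    using that
  proof (induction m arbitrary: c)
    case 0
    then show ?case using mgf[of c] by (simp add: lessThan_atLeast0)
  next
    case (Suc m)
    then have mk: "m < k" by simp
    define U where "U \<omega> = (\<Sum>j<m. (Z j \<omega>)\<^sup>2) / (4 * s) + (\<Sum>j=Suc m..<k. c j * Z j \<omega>)" for \<omega>
    have [measurable]: "U \<in> borel_measurable M" unfolding U_def by measurable
    define V where "V = s / 2 * (\<Sum>j=Suc m..<k. (c j)\<^sup>2)"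
    have avg: "ennreal (exp ((\<Sum>j<Suc m. (Z j \<omega>)\<^sup>2) / (4 * s) + (\<Sum>j=Suc m..<k. c j * Z j \<omega>)))
        = (\<integral>\<^sup>+x. ennreal (exp (U \<omega> + x / sqrt (2 * s) * Z m \<omega>)) \<partial>std_normal_distribution)" for \<omega>
    proof -
      have "(Z m \<omega> / sqrt (2 * s))\<^sup>2 / 2 = (Z m \<omega>)\<^sup>2 / (4 * s)"
        using s by (simp add: power_divide)
      then have "(\<Sum>j<Suc m. (Z j \<omega>)\<^sup>2) / (4 * s) + (\<Sum>j=Suc m..<k. c j * Z j \<omega>)
          = U \<omega> + (Z m \<omega> / sqrt (2 * s))\<^sup>2 / 2"
        by (simp add: U_def add_divide_distrib)
      then have "ennreal (exp ((\<Sum>j<Suc m. (Z j \<omega>)\<^sup>2) / (4 * s) + (\<Sum>j=Suc m..<k. c j * Z j \<omega>)))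
          = ennreal (exp (U \<omega>)) * (\<integral>\<^sup>+x. ennreal (exp (Z m \<omega> / sqrt (2 * s) * x)) \<partial>std_normal_distribution)"
        unfolding std_normal_mgf by (simp add: exp_add ennreal_mult')
      also have "\<dots> = (\<integral>\<^sup>+x. ennreal (exp (U \<omega>)) * ennreal (exp (Z m \<omega> / sqrt (2 * s) * x)) \<partial>std_normal_distribution)"
        by (subst nn_integral_cmult) auto
      finally show ?thesis by (simp add: exp_add ennreal_mult' mult.commute)
    qed
    have inner: "(\<integral>\<^sup>+\<omega>. ennreal (exp (U \<omega> + x / sqrt (2 * s) * Z m \<omega>)) \<partial>M)
        \<le> ennreal (sqrt 2 ^ m * exp V) * ennreal (exp (x\<^sup>2 / 4))" for x
    proof -
      \<comment> \<open>The averaging variable becomes the coefficient of coordinate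
        \<open>m\<close>; this is why the induction allows arbitrary linear coefficients beyond the
        block already squared.\<close>
      define c' where "c' = c(m := x / sqrt (2 * s))"
      have split: "(\<Sum>j=m..<k. f j) = f m + (\<Sum>j=Suc m..<k. f j)" for f :: "nat \<Rightarrow> real"
        using mk by (rule sum.atLeast_Suc_lessThan)
      have eq1: "U \<omega> + x / sqrt (2 * s) * Z m \<omega>
          = (\<Sum>j<m. (Z j \<omega>)\<^sup>2) / (4 * s) + (\<Sum>j=m..<k. c' j * Z j \<omega>)" for \<omega>
        unfolding split U_def by (auto simp: c'_def intro!: sum.cong)
      \<comment> \<open>The scale \<open>1 / sqrt (2 * s)\<close> leaves \<open>x^2 / 4\<close> in
        the exponent, which is still integrable against the standard normal law and costs a factor
        \<open>sqrt 2\<close> per coordinate.\<close>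
      have eq2: "s / 2 * (\<Sum>j=m..<k. (c' j)\<^sup>2) = V + x\<^sup>2 / 4"
      proof -
        have "(\<Sum>j=Suc m..<k. (c' j)\<^sup>2) = (\<Sum>j=Suc m..<k. (c j)\<^sup>2)"
          by (intro sum.cong) (auto simp: c'_def)
        then show ?thesis
          unfolding split V_def using s by (simp add: c'_def power_divide field_simps)
      qed
      have "(\<integral>\<^sup>+\<omega>. ennreal (exp (U \<omega> + x / sqrt (2 * s) * Z m \<omega>)) \<partial>M)
          \<le> ennreal (sqrt 2 ^ m * exp (V + x\<^sup>2 / 4))"
        using Suc.IH[of c'] mk unfolding eq1 eq2 by simp
      then show ?thesis by (simp add: exp_add mult.assoc flip: ennreal_mult')
    qed
    have "(\<integral>\<^sup>+\<omega>. ennreal (exp ((\<Sum>j<Suc m. (Z j \<omega>)\<^sup>2) / (4 * s) + (\<Sum>j=Suc m..<k. c j * Z j \<omega>))) \<partial>M)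
        = (\<integral>\<^sup>+x. (\<integral>\<^sup>+\<omega>. ennreal (exp (U \<omega> + x / sqrt (2 * s) * Z m \<omega>)) \<partial>M) \<partial>std_normal_distribution)"
      unfolding avg by (rule MN.Fubini'[symmetric]) measurable
    also have "\<dots> \<le> (\<integral>\<^sup>+x. ennreal (sqrt 2 ^ m * exp V) * ennreal (exp (x\<^sup>2 / 4)) \<partial>std_normal_distribution)"
      by (intro nn_integral_mono inner)
    also have "\<dots> = ennreal (sqrt 2 ^ m * exp V) * ennreal (sqrt 2)"
      by (subst nn_integral_cmult) (auto simp: std_normal_exp_square)
    also have "\<dots> = ennreal (sqrt 2 ^ Suc m * exp V)"
      by (simp add: mult_ac flip: ennreal_mult')
    finally show ?case unfolding V_def .
  qed
  from this[of k "\<lambda>_. 0"] show ?thesis by simp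
qed

text \<open>The dimension enters only through \<open>sqrt 2 ^ k\<close>, a factor that the growth
  condition on \<open>k\<close> can absorb into the exponent.\<close>

lemma (in prob_space) subgaussian_concentration:
  fixes Z :: "nat \<Rightarrow> 'a \<Rightarrow> real"
  assumes [measurable]: "\<And>j. Z j \<in> borel_measurable M"
    and s: "s > 0"
    and mgf: "\<And>c. (\<integral>\<^sup>+\<omega>. ennreal (exp (\<Sum>j<k. c j * Z j \<omega>)) \<partial>M) \<le> ennreal (exp (s / 2 * (\<Sum>j<k. (c j)\<^sup>2)))"
  shows "emeasure M {\<omega>\<in>space M. a\<^sup>2 \<le> (\<Sum>j<k. (Z j \<omega>)\<^sup>2)} \<le> ennreal (sqrt 2 ^ k * exp (- a\<^sup>2 / (4 * s)))"
proof -
  let ?u = "\<lambda>\<omega>. ennreal (exp ((\<Sum>j<k. (Z j \<omega>)\<^sup>2) / (4 * s)))"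
  let ?c = "ennreal (exp (- a\<^sup>2 / (4 * s)))"
  have "emeasure M {\<omega>\<in>space M. a\<^sup>2 \<le> (\<Sum>j<k. (Z j \<omega>)\<^sup>2)} \<le> emeasure M ({\<omega>\<in>space M. 1 \<le> ?c * ?u \<omega>})"
  proof (rule emeasure_mono)
    show "{\<omega>\<in>space M. a\<^sup>2 \<le> (\<Sum>j<k. (Z j \<omega>)\<^sup>2)} \<subseteq> {\<omega>\<in>space M. 1 \<le> ?c * ?u \<omega>}"
    proof safe
      fix \<omega> assume "a\<^sup>2 \<le> (\<Sum>j<k. (Z j \<omega>)\<^sup>2)"
      then have "a\<^sup>2 / (4 * s) \<le> (\<Sum>j<k. (Z j \<omega>)\<^sup>2) / (4 * s)"
        using s by (intro divide_right_mono) auto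
      then have "1 \<le> exp (- a\<^sup>2 / (4 * s)) * exp ((\<Sum>j<k. (Z j \<omega>)\<^sup>2) / (4 * s))"
        unfolding exp_add[symmetric] by simp
      then show "1 \<le> ?c * ?u \<omega>" by (simp flip: ennreal_mult')
    qed
  qed measurable
  also have "\<dots> \<le> ?c * (\<integral>\<^sup>+\<omega>. ?u \<omega> * indicator (space M) \<omega> \<partial>M)"
    using nn_integral_Markov_inequality[of ?u "space M" M ?c] by (simp add: Int_def conj_commute)
  also have "(\<integral>\<^sup>+\<omega>. ?u \<omega> * indicator (space M) \<omega> \<partial>M) = (\<integral>\<^sup>+\<omega>. ?u \<omega> \<partial>M)"
    by (intro nn_integral_cong) simp
  also have "?c * \<dots> \<le> ?c * ennreal (sqrt 2 ^ k)"
    by (intro mult_left_mono subgaussian_square_mgf s mgf) auto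
  also have "\<dots> = ennreal (sqrt 2 ^ k * exp (- a\<^sup>2 / (4 * s)))"
    by (simp add: mult.commute flip: ennreal_mult')
  finally show ?thesis .
qed

section \<open>The adjoint inverse and the linear estimator\<close>

locale inverse_problem = gaussian_model \<zeta> b G P \<eta> n L + phi: onb \<phi>
  for \<zeta> :: "'b::{real_inner, polish_space} \<Rightarrow> 'b" and b
    and G :: "'a::{real_inner, polish_space} \<Rightarrow> 'b"
    and P :: "'o measure" and \<eta> n L
    and \<phi> :: "nat \<Rightarrow> 'a" +
  assumes S_defined: "\<And>j. \<phi> j \<in> inv_adjoint_dom G"
begin

lemma adjoint_G: "x \<bullet> adjoint G y = G x \<bullet> y"
  by (rule phi.adjoint_inner[OF bounded_linear_G])

lemma adjoint_G_linear: "linear (adjoint G)"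
  by (rule linearI; rule phi.eqI)
    (simp_all add: inner_commute[of _ "\<phi> _"] adjoint_G inner_add_right)

text \<open>Two candidates differ by a vector in the kernel of the adjoint, which is orthogonal to
  the closed range; but the candidates themselves lie there.\<close>

lemma inv_adjointI:
  assumes w: "w \<in> closure (range G)"
  shows "inv_adjoint G (adjoint G w) = w"
  unfolding inv_adjoint_def
proof (rule the_equality)
  show "w \<in> closure (range G) \<and> adjoint G w = adjoint G w" using w by simp
  fix v assume v: "v \<in> closure (range G) \<and> adjoint G v = adjoint G w"
  have "closure (range G) \<subseteq> {x. x \<bullet> (v - w) = 0}"
  proof (rule closure_minimal)
    show "closed {x. x \<bullet> (v - w) = 0}" by (intro closed_Collect_eq continuous_intros)
    have "G x \<bullet> (v - w) = 0" for x
      using v by (simp add: inner_diff_right flip: adjoint_G)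
    then show "range G \<subseteq> {x. x \<bullet> (v - w) = 0}" by auto
  qed
  then have "v \<bullet> (v - w) = 0" "w \<bullet> (v - w) = 0" using v w by auto
  then have "(v - w) \<bullet> (v - w) = 0" by (simp only: inner_diff_left diff_self)
  then show "v = w" by simp
qed

lemma inv_adjoint_basis: "inv_adjoint G (\<phi> j) \<in> closure (range G)"
  "adjoint G (inv_adjoint G (\<phi> j)) = \<phi> j"
proof -
  obtain w where "w \<in> closure (range G)" "adjoint G w = \<phi> j"
    using S_defined[of j] by (auto simp: inv_adjoint_dom_def)
  then show "inv_adjoint G (\<phi> j) \<in> closure (range G)" "adjoint G (inv_adjoint G (\<phi> j)) = \<phi> j"
    using inv_adjointI by metis+
qed

lemma subspace_closure_range: "subspace (closure (range G))"
proof (rule subspaceI)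
  show "0 \<in> closure (range G)"
    using closure_subset[of "range G"] G.zero by (metis rangeI subsetD)
  show "x + y \<in> closure (range G)" if xy: "x \<in> closure (range G)" "y \<in> closure (range G)" for x y
  proof -
    obtain f g where f: "\<And>n. f n \<in> range G" "f \<longlonglongrightarrow> x" and g: "\<And>n. g n \<in> range G" "g \<longlonglongrightarrow> y"
      using xy unfolding closure_sequential by blast
    have "f n + g n \<in> range G" for n
      using subspace_add[OF linear_subspace_image[OF G.linear subspace_UNIV] f(1) g(1)] .
    moreover have "(\<lambda>n. f n + g n) \<longlonglongrightarrow> x + y" by (intro tendsto_add f g)
    ultimately show ?thesis unfolding closure_sequential by (intro exI[of _ "\<lambda>n. f n + g n"]) simp
  qed
  show "c *\<^sub>R x \<in> closure (range G)" if x: "x \<in> closure (range G)" for c x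
  proof -
    obtain f where f: "\<And>n. f n \<in> range G" "f \<longlonglongrightarrow> x"
      using x unfolding closure_sequential by blast
    have "c *\<^sub>R f n \<in> range G" for n
      using subspace_scale[OF linear_subspace_image[OF G.linear subspace_UNIV] f(1)] .
    moreover have "(\<lambda>n. c *\<^sub>R f n) \<longlonglongrightarrow> c *\<^sub>R x" by (intro tendsto_intros f)
    ultimately show ?thesis unfolding closure_sequential by (intro exI[of _ "\<lambda>n. c *\<^sub>R f n"]) simp
  qed
qed

text \<open>Combinations of the values on the basis stay in the closed range, so the description
  picks exactly them.\<close>

lemma inv_adjoint_sum: "inv_adjoint G (\<Sum>j\<in>J. c j *\<^sub>R \<phi> j) = (\<Sum>j\<in>J. c j *\<^sub>R inv_adjoint G (\<phi> j))"
proof -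
  have "(\<Sum>j\<in>J. c j *\<^sub>R \<phi> j) = adjoint G (\<Sum>j\<in>J. c j *\<^sub>R inv_adjoint G (\<phi> j))"
    by (simp add: linear_sum[OF adjoint_G_linear] linear_scale[OF adjoint_G_linear] inv_adjoint_basis)
  then show ?thesis
    by (simp add: inv_adjointI subspace_sum[OF subspace_closure_range]
        subspace_scale[OF subspace_closure_range] inv_adjoint_basis)
qed

definition direction :: "nat \<Rightarrow> 'b" where
  "direction j = op_sqrt \<zeta> (inv_adjoint G (\<phi> j))"

definition estimator :: "nat \<Rightarrow> (nat \<Rightarrow> real) \<Rightarrow> real" where
  "estimator j y = L y (op_sqrt \<zeta> (direction j))"

lemma gauss_estimator: "gauss (estimator j) (direction j)"
  unfolding estimator_def[abs_def] by (rule gauss_L)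

lemma estimator_measurable [measurable]: "estimator j \<in> borel_measurable data_space"
  by (rule gauss_measurable[OF gauss_estimator])

text \<open>Unbiasedness of the estimator: by \<open>tilted_mgf\<close> the left side is its mean
  under parameter \<open>u\<close>.\<close>

lemma direction_whitened: "direction j \<bullet> whitened u = u \<bullet> \<phi> j"
proof -
  have "direction j \<bullet> whitened u = inv_adjoint G (\<phi> j) \<bullet> G u"
    by (simp add: direction_def root_inner root_whitened)
  also have "\<dots> = u \<bullet> \<phi> j"
    using adjoint_G[of u "inv_adjoint G (\<phi> j)"] by (simp add: inv_adjoint_basis inner_commute)
  finally show ?thesis .
qed

lemma root_inv_adjoint_sum: "op_sqrt \<zeta> (inv_adjoint G (\<Sum>j\<in>J. c j *\<^sub>R \<phi> j)) = (\<Sum>j\<in>J. c j *\<^sub>R direction j)"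
  by (simp add: inv_adjoint_sum root.sum root.scale direction_def)

text \<open>A real supremum dominates its members only for a set bounded above. Coefficients of
  vectors in the unit ball are at most 1, so a crude triangle inequality suffices.\<close>

lemma noise_gain_bdd:
  "bdd_above ((\<lambda>h. (norm (op_sqrt \<zeta> (inv_adjoint G h)))\<^sup>2) ` {h \<in> span (\<phi> ` {..<k}). norm h \<le> 1})"
proof (rule bdd_aboveI2)
  fix h assume "h \<in> {h \<in> span (\<phi> ` {..<k}). norm h \<le> 1}"
  then have h: "h = (\<Sum>j<k. (h \<bullet> \<phi> j) *\<^sub>R \<phi> j)" "norm h \<le> 1"
    using phi.span_repr[of "{..<k}" h] by auto
  have "norm (\<phi> j) = 1" for j by (simp add: norm_eq_sqrt_inner phi.inner_basis)
  then have coef: "\<bar>h \<bullet> \<phi> j\<bar> \<le> 1" for j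
    using Cauchy_Schwarz_ineq2[of h "\<phi> j"] h(2) by simp
  have "norm (op_sqrt \<zeta> (inv_adjoint G h)) \<le> (\<Sum>j<k. norm ((h \<bullet> \<phi> j) *\<^sub>R direction j))"
    by (subst h(1), subst root_inv_adjoint_sum) (rule norm_sum)
  also have "\<dots> \<le> (\<Sum>j<k. norm (direction j))"
    using coef by (intro sum_mono) (simp add: mult_left_le_one_le)
  finally show "(norm (op_sqrt \<zeta> (inv_adjoint G h)))\<^sup>2 \<le> (\<Sum>j<k. norm (direction j))\<^sup>2"
    by (intro power_mono) auto
qed

text \<open>By homogeneity the supremum over the unit ball bounds the quadratic form of the
  estimator covariance, up to the factor \<open>1 / n\<close>.\<close>

lemma norm_direction_sum_le:
  "(norm (\<Sum>j<k. c j *\<^sub>R direction j))\<^sup>2 \<le> noise_gain \<zeta> G \<phi> k * (\<Sum>j<k. (c j)\<^sup>2)"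
proof (cases "(\<Sum>j<k. (c j)\<^sup>2) = 0")
  case True
  then have "\<forall>j<k. c j = 0" by (subst (asm) sum_nonneg_eq_0_iff) auto
  then show ?thesis using True by simp
next
  case False
  define h where "h = (\<Sum>j<k. c j *\<^sub>R \<phi> j)"
  have nh: "(norm h)\<^sup>2 = (\<Sum>j<k. (c j)\<^sup>2)" unfolding h_def by (rule phi.norm_sum_basis) simp
  then have h0: "norm h > 0" using False by auto
  define h' where "h' = (\<Sum>j<k. (c j / norm h) *\<^sub>R \<phi> j)"
  have h': "h' = (1 / norm h) *\<^sub>R h"
    by (simp add: h'_def scaleR_sum_right) (simp add: h_def scaleR_sum_right)
  have "h \<in> span (\<phi> ` {..<k})"
    unfolding h_def by (intro span_sum span_scale span_base) auto
  then have "h' \<in> {h \<in> span (\<phi> ` {..<k}). norm h \<le> 1}"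
    using h0 unfolding h' by (auto intro!: span_scale)
  then have "(norm (op_sqrt \<zeta> (inv_adjoint G h')))\<^sup>2 \<le> noise_gain \<zeta> G \<phi> k"
    unfolding noise_gain_def by (rule cSUP_upper[OF _ noise_gain_bdd])
  moreover have "op_sqrt \<zeta> (inv_adjoint G h') = (1 / norm h) *\<^sub>R (\<Sum>j<k. c j *\<^sub>R direction j)"
    unfolding h'_def root_inv_adjoint_sum by (simp add: scaleR_sum_right)
  ultimately have "(norm (\<Sum>j<k. c j *\<^sub>R direction j))\<^sup>2 / (norm h)\<^sup>2 \<le> noise_gain \<zeta> G \<phi> k"
    by (simp add: power_divide)
  then show ?thesis using h0 by (simp add: nh[symmetric] pos_divide_le_eq)
qed

text \<open>The exponential moments of the centred estimator do not involve \<open>u\<close>. The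
  variance proxy \<open>s\<close> is a free positive number because only an upper bound for the gain
  is available in the application.\<close>

lemma estimator_concentration:
  assumes s: "s > 0" and gain: "noise_gain \<zeta> G \<phi> k \<le> real n * s"
  shows "emeasure (data_law P b \<eta> G n u) {y. a\<^sup>2 \<le> (\<Sum>j<k. (estimator j y - u \<bullet> \<phi> j)\<^sup>2)}
      \<le> ennreal (sqrt 2 ^ k * exp (- a\<^sup>2 / (4 * s)))"
proof -
  interpret Q: prob_space "data_law P b \<eta> G n u" by (rule prob_data_law)
  note [measurable_cong] = sets_data_law
  have mgf: "(\<integral>\<^sup>+y. ennreal (exp (\<Sum>j<k. c j * (estimator j y - u \<bullet> \<phi> j))) \<partial>data_law P b \<eta> G n u)
      \<le> ennreal (exp (s / 2 * (\<Sum>j<k. (c j)\<^sup>2)))" for c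
  proof -
    define z where "z = (\<Sum>j<k. c j *\<^sub>R direction j)"
    define t where "t = (\<Sum>j<k. c j * (u \<bullet> \<phi> j))"
    have g: "gauss (\<lambda>y. \<Sum>j<k. c j * estimator j y) z"
      unfolding z_def by (intro gauss_sum gauss_estimator)
    have zt: "z \<bullet> whitened u = t"
      by (simp add: z_def t_def inner_sum_left direction_whitened)
    have "(\<integral>\<^sup>+y. ennreal (exp (\<Sum>j<k. c j * (estimator j y - u \<bullet> \<phi> j))) \<partial>data_law P b \<eta> G n u)
        = (\<integral>\<^sup>+y. ennreal (exp (- t)) * ennreal (exp (\<Sum>j<k. c j * estimator j y) * likelihood u y) \<partial>\<gamma>)"
      unfolding Cameron_Martin_density[of u] using likelihood_pos
      by (subst nn_integral_density)
        (auto intro!: nn_integral_cong simp: t_def right_diff_distrib sum_subtractf exp_diff exp_minus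
          field_simps less_imp_le simp flip: ennreal_mult)
    also have "\<dots> = ennreal (exp (- t)) * ennreal (exp (t + (norm z)\<^sup>2 / (2 * real n)))"
      by (subst nn_integral_cmult) (auto simp: tilted_mgf[OF g] zt)
    also have "\<dots> = ennreal (exp ((norm z)\<^sup>2 / (2 * real n)))"
      by (simp flip: ennreal_mult' exp_add)
    also have "\<dots> \<le> ennreal (exp (s / 2 * (\<Sum>j<k. (c j)\<^sup>2)))"
    proof -
      have "(norm z)\<^sup>2 \<le> noise_gain \<zeta> G \<phi> k * (\<Sum>j<k. (c j)\<^sup>2)"
        unfolding z_def by (rule norm_direction_sum_le)
      also have "\<dots> \<le> (real n * s) * (\<Sum>j<k. (c j)\<^sup>2)"
        by (intro mult_right_mono gain sum_nonneg) auto
      finally show ?thesis using n_pos by (simp add: field_simps)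
    qed
    finally show ?thesis .
  qed
  show ?thesis
    using Q.subgaussian_concentration[OF _ s mgf, of a] by (simp add: space_data_law)
qed

end

section \<open>Posterior contraction\<close>

context gaussian_model
begin

text \<open>The inverse of the root is in general unbounded, so continuity of
  \<open>whitened\<close> is not immediate. Its norm, however, is a supremum of continuous functions
  of \<open>u\<close>, namely of \<open>G u \<bullet> w\<close> over
  \<open>norm (op_sqrt \<zeta> w)\<close>, so sublevel sets are intersections of closed
  sets.\<close>

lemma closed_whitened_le: "closed {u. norm (whitened u) \<le> a}"
proof (cases "a < 0")
  case True
  then have "{u. norm (whitened u) \<le> a} = {}"
    by (auto simp: not_le intro: less_le_trans)
  then show ?thesis by simp
next
  case False
  have "{u. norm (whitened u) \<le> a} = (\<Inter>w. {u. G u \<bullet> w \<le> a * norm (op_sqrt \<zeta> w)})"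
  proof safe
    fix u w assume "norm (whitened u) \<le> a"
    have "G u \<bullet> w = whitened u \<bullet> op_sqrt \<zeta> w" by (simp add: root_inner flip: root_whitened)
    also have "\<dots> \<le> norm (whitened u) * norm (op_sqrt \<zeta> w)" by (rule norm_cauchy_schwarz)
    also have "\<dots> \<le> a * norm (op_sqrt \<zeta> w)"
      by (intro mult_right_mono \<open>norm (whitened u) \<le> a\<close>) simp
    finally show "G u \<bullet> w \<le> a * norm (op_sqrt \<zeta> w)" .
  next
    fix u assume u: "u \<in> (\<Inter>w. {u. G u \<bullet> w \<le> a * norm (op_sqrt \<zeta> w)})"
    \<comment> \<open>The inequality is known on the dense range of the root; after closing up it
      may be tested at \<open>whitened u\<close> itself.\<close>
    have "closure (range (op_sqrt \<zeta>)) \<subseteq> {z. whitened u \<bullet> z \<le> a * norm z}"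
    proof (rule closure_minimal)
      show "closed {z. whitened u \<bullet> z \<le> a * norm z}"
        by (intro closed_Collect_le continuous_intros)
      show "range (op_sqrt \<zeta>) \<subseteq> {z. whitened u \<bullet> z \<le> a * norm z}"
        using u by (auto simp: root_inner[symmetric] root_whitened)
    qed
    then have "whitened u \<bullet> whitened u \<le> a * norm (whitened u)"
      unfolding range_root_dense by blast
    then have "norm (whitened u) * norm (whitened u) \<le> a * norm (whitened u)"
      by (simp add: power2_norm_eq_inner[symmetric] power2_eq_square)
    then show "norm (whitened u) \<le> a"
      using False by (cases "norm (whitened u) = 0") auto
  qed
  also have "closed \<dots>"
    by (intro closed_INT ballI closed_Collect_le continuous_intros G.continuous_on)
  finally show ?thesis .
qed

lemma norm_whitened_measurable [measurable]: "(\<lambda>u. norm (whitened u)) \<in> borel_measurable borel"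
proof (rule borel_measurableI_le)
  show "{u \<in> space borel. norm (whitened u) \<le> a} \<in> sets borel" for a
    using borel_closed[OF closed_whitened_le[of a]] by simp
qed

lemma likelihood_joint_measurable [measurable]:
  "(\<lambda>(y, u). likelihood u y) \<in> borel_measurable (data_space \<Otimes>\<^sub>M borel)"
proof -
  have [measurable]: "G \<in> borel_measurable borel"
    by (intro borel_measurable_continuous_onI G.continuous_on continuous_on_id)
  have "(\<lambda>(y, u). (y, G u)) \<in> measurable (data_space \<Otimes>\<^sub>M borel) (data_space \<Otimes>\<^sub>M borel)"
    by measurable
  from measurable_compose[OF this L_measurable]
  have [measurable]: "(\<lambda>p. L (fst p) (G (snd p))) \<in> borel_measurable (data_space \<Otimes>\<^sub>M borel)"
    by (simp add: case_prod_beta')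
  show ?thesis
    unfolding likelihood_eq case_prod_beta' by measurable
qed

lemma likelihood_parameter_measurable: "(\<lambda>u. likelihood u y) \<in> borel_measurable borel"
proof -
  have "y \<in> space data_space" by (simp add: space_PiM)
  from measurable_compose_Pair1[OF this likelihood_joint_measurable] show ?thesis
    by (simp only: prod.case)
qed

lemma whitened_dist_measurable [measurable]: "(\<lambda>u. norm (whitened (u - u0))) \<in> borel_measurable borel"
proof -
  have "(\<lambda>u. u - u0) \<in> borel_measurable borel"
    by (intro borel_measurable_continuous_onI continuous_intros)
  from measurable_compose[OF this norm_whitened_measurable] show ?thesis .
qed

text \<open>As a second moment under parameter \<open>u\<close> this is one plus the chi-square
  divergence between the two data laws; it is again an instance of
  \<open>tilted_mgf\<close>.\<close>

lemma likelihood_ratio_second_moment: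
  "(\<integral>\<^sup>+y. ennreal (likelihood u0 y / likelihood u y) \<partial>data_law P b \<eta> G n u0)
    = ennreal (exp (real n * (norm (whitened (u - u0)))\<^sup>2))"
proof -
  define p q where "p = whitened u0" and "q = whitened u"
  define z where "z = real n *\<^sub>R p + (- real n) *\<^sub>R q"
  define t where "t = real n / 2 * (norm q)\<^sup>2 - real n / 2 * (norm p)\<^sup>2"
  have g: "gauss (\<lambda>y. real n * L y (G u0) + (- real n) * L y (G u)) z"
    unfolding z_def p_def q_def by (intro gauss_add_scale gauss_scale gauss_L_G)
  note [measurable] = gauss_measurable[OF g] gauss_measurable[OF gauss_L_G[of u0]]
    gauss_measurable[OF gauss_L_G[of u]]
  have ratio: "likelihood u0 y / likelihood u y
      = exp t * exp (real n * L y (G u0) + (- real n) * L y (G u))" for y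
    unfolding likelihood_eq exp_diff[symmetric] exp_add[symmetric] t_def p_def q_def
    by (simp add: algebra_simps)
  have "(\<integral>\<^sup>+y. ennreal (likelihood u0 y / likelihood u y) \<partial>data_law P b \<eta> G n u0)
      = (\<integral>\<^sup>+y. ennreal (exp t) *
          ennreal (exp (real n * L y (G u0) + (- real n) * L y (G u)) * likelihood u0 y) \<partial>\<gamma>)"
    unfolding Cameron_Martin_density[of u0] ratio using likelihood_pos
    by (subst nn_integral_density)
      (auto intro!: nn_integral_cong simp: mult_ac less_imp_le simp flip: ennreal_mult)
  also have "\<dots> = ennreal (exp t) * ennreal (exp (z \<bullet> p + (norm z)\<^sup>2 / (2 * real n)))"
    by (subst nn_integral_cmult) (use tilted_mgf[OF g, of u0] in \<open>auto simp: p_def\<close>)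
  also have "\<dots> = ennreal (exp (t + (z \<bullet> p + (norm z)\<^sup>2 / (2 * real n))))"
    by (simp add: exp_add flip: ennreal_mult')
  also have "t + (z \<bullet> p + (norm z)\<^sup>2 / (2 * real n)) = real n * (norm (q - p))\<^sup>2"
    using n_pos unfolding t_def z_def power2_norm_eq_inner
    by (simp add: inner_add_left inner_add_right inner_diff_left inner_diff_right inner_commute
        power2_eq_square field_simps)
  finally show ?thesis by (simp add: p_def q_def whitened_diff)
qed

end

section \<open>Bounds for evidence, numerator and posterior mass\<close>

locale prior_model = inverse_problem \<zeta> b G P \<eta> n L \<phi> + prior: prob_space \<mu>
  for \<zeta> :: "'b::{real_inner, polish_space} \<Rightarrow> 'b" and b
    and G :: "'a::{real_inner, polish_space} \<Rightarrow> 'b"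
    and P :: "'o measure" and \<eta> n L
    and \<phi> :: "nat \<Rightarrow> 'a" and \<mu> :: "'a measure" +
  assumes sets_prior [measurable_cong]: "sets \<mu> = sets borel"
begin

declare sets_data_law [measurable_cong]

abbreviation Q :: "'a \<Rightarrow> (nat \<Rightarrow> real) measure" where
  "Q v \<equiv> data_law P b \<eta> G n v"

sublocale Q: prob_space "Q v" for v by (rule prob_data_law)

lemma pair_sigma_finite_Q: "pair_sigma_finite (Q v) \<mu>"
  by unfold_locales

lemma emeasure_Q:
  assumes "A \<in> sets data_space"
  shows "emeasure (Q v) A = (\<integral>\<^sup>+y. ennreal (likelihood v y) * indicator A y \<partial>\<gamma>)"
  unfolding Cameron_Martin_density[of v] using assms
  by (subst emeasure_density) (auto simp: sets_data_law)

lemma space_prior: "space \<mu> = UNIV"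
  using sets_eq_imp_space_eq[OF sets_prior] by simp

text \<open>A second moment bound on the likelihood ratio replaces Jensen's inequality:
  \<open>2 \<le> K r + 1 / (K r)\<close> turns an upper bound for the integral of \<open>1 / r\<close> into a lower bound
  for that of \<open>r\<close>.\<close>

lemma evidence_lower_bound:
  fixes u0 :: 'a and \<epsilon> :: real
  defines "F \<equiv> {u. norm (whitened (u - u0)) \<le> \<epsilon>}"
  assumes F: "measure \<mu> F > 0" and \<epsilon>: "\<epsilon> \<ge> 0"
  obtains E where "E \<in> sets data_space" "emeasure (Q u0) E \<le> ennreal (exp (- (real n * \<epsilon>\<^sup>2)))"
    "\<And>y. y \<notin> E \<Longrightarrow> ennreal (likelihood u0 y * exp (- (2 * real n * \<epsilon>\<^sup>2)) * measure \<mu> F)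
      \<le> (\<integral>\<^sup>+u. ennreal (likelihood u y) \<partial>\<mu>)"
proof -
  define x where "x = real n * \<epsilon>\<^sup>2"
  \<comment> \<open>One factor \<open>exp x\<close> offsets the moment bound on \<open>F\<close>;
    the other leaves probability \<open>exp (- x)\<close> for the exceptional event.\<close>
  define K where "K = exp (2 * x)"
  define m where "m = measure \<mu> F"
  have K: "K > 0" by (simp add: K_def)
  have m: "m > 0" using F by (simp add: m_def)
  interpret PS: pair_sigma_finite "Q u0" \<mu> by (rule pair_sigma_finite_Q)
  have F_meas [measurable]: "F \<in> sets borel" unfolding F_def by measurable
  have mF: "emeasure \<mu> F = ennreal m" by (simp add: prior.emeasure_eq_measure m_def)
  define W where "W y = (\<integral>\<^sup>+u. ennreal (likelihood u0 y / likelihood u y) * indicator F u \<partial>\<mu>)" for y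
  have W_meas [measurable]: "W \<in> borel_measurable data_space"
    unfolding W_def by measurable
  define E where "E = {y. 1 \<le> ennreal (1 / (K * m)) * W y}"
  show thesis
  proof (rule that[of E])
    have "E = {y \<in> space data_space. 1 \<le> ennreal (1 / (K * m)) * W y}"
      by (simp add: E_def space_PiM)
    also have "\<dots> \<in> sets data_space" by measurable
    finally show E_sets: "E \<in> sets data_space" .
    have "(\<integral>\<^sup>+y. W y \<partial>Q u0)
        = (\<integral>\<^sup>+u. (\<integral>\<^sup>+y. ennreal (likelihood u0 y / likelihood u y) * indicator F u \<partial>Q u0) \<partial>\<mu>)"
      unfolding W_def by (rule PS.Fubini'[symmetric]) measurable
    also have "\<dots> = (\<integral>\<^sup>+u. ennreal (exp (real n * (norm (whitened (u - u0)))\<^sup>2)) * indicator F u \<partial>\<mu>)"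
      by (intro nn_integral_cong, subst nn_integral_multc)
        (auto simp: likelihood_ratio_second_moment)
    also have "\<dots> \<le> (\<integral>\<^sup>+u. ennreal (exp x) * indicator F u \<partial>\<mu>)"
      using n_pos \<epsilon> unfolding x_def F_def
      by (intro nn_integral_mono) (auto simp: indicator_def intro!: ennreal_leI power_mono)
    also have "\<dots> = ennreal (exp x) * ennreal m"
      by (subst nn_integral_cmult) (auto simp: mF)
    finally have W_int: "(\<integral>\<^sup>+y. W y \<partial>Q u0) \<le> ennreal (exp x * m)"
      using m by (simp add: ennreal_mult')
    have "emeasure (Q u0) E \<le> ennreal (1 / (K * m)) * (\<integral>\<^sup>+y. W y * indicator UNIV y \<partial>Q u0)"
      using nn_integral_Markov_inequality[of W UNIV "Q u0" "ennreal (1 / (K * m))"]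
        sets.top[of "Q u0"] by (simp add: E_def space_data_law)
    also have "\<dots> \<le> ennreal (1 / (K * m)) * ennreal (exp x * m)"
      using W_int by (intro mult_left_mono) auto
    also have "\<dots> = ennreal (exp (- x))"
    proof -
      have "K * exp (- x) = exp x" by (simp add: K_def flip: exp_add)
      then have "1 / (K * m) * (exp x * m) = exp (- x)" using m K by (simp add: field_simps)
      then show ?thesis using m K by (simp flip: ennreal_mult')
    qed
    finally show "emeasure (Q u0) E \<le> ennreal (exp (- (real n * \<epsilon>\<^sup>2)))" by (simp add: x_def)
    fix y assume "y \<notin> E"
    then have WE: "ennreal (1 / (K * m)) * W y \<le> 1" by (simp add: E_def)
    have "ennreal (1 / K) * W y = ennreal m * (ennreal (1 / (K * m)) * W y)"
      using m K by (simp add: mult.assoc[symmetric] flip: ennreal_mult')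
    also have "\<dots> \<le> ennreal m" using mult_left_mono[OF WE, of "ennreal m"] by simp
    finally have WK: "ennreal (1 / K) * W y \<le> ennreal m" .
    define V where "V = (\<integral>\<^sup>+u. ennreal (likelihood u y) \<partial>\<mu>)"
    define l where "l = likelihood u0 y"
    have l: "l > 0" unfolding l_def by (rule likelihood_pos)
    note [measurable] = likelihood_parameter_measurable[of y]
    \<comment> \<open>Integrating the inequality for \<open>K r\<close> over \<open>F\<close> puts
      twice the mass of \<open>F\<close> on the left; one copy cancels against
      \<open>WK\<close>.\<close>
    have "ennreal m + ennreal m = (\<integral>\<^sup>+u. ennreal 2 * indicator F u \<partial>\<mu>)"
      by (subst nn_integral_cmult) (auto simp: mF mult_2)
    also have "\<dots> \<le> (\<integral>\<^sup>+u. ennreal (K / l) * ennreal (likelihood u y)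
        + ennreal (1 / K) * (ennreal (l / likelihood u y) * indicator F u) \<partial>\<mu>)"
    proof (intro nn_integral_mono)
      fix u
      have r: "likelihood u y > 0" by (rule likelihood_pos)
      define w where "w = K / l * likelihood u y"
      have w: "w > 0" using K l r by (simp add: w_def)
      have "0 \<le> (w - 1)\<^sup>2 / w" using w by simp
      also have "\<dots> = w + 1 / w - 2" using w by (simp add: power2_eq_square field_simps)
      finally have "2 \<le> K / l * likelihood u y + 1 / K * (l / likelihood u y)"
        by (simp add: w_def)
      then have "ennreal 2 \<le> ennreal (K / l * likelihood u y + 1 / K * (l / likelihood u y))"
        by (rule ennreal_leI)
      also have "\<dots> = ennreal (K / l) * ennreal (likelihood u y) + ennreal (1 / K) * ennreal (l / likelihood u y)"
        using K l r by (simp only: ennreal_plus ennreal_mult zero_le_divide_iff zero_le_mult_iff less_imp_le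
            zero_le_one simp_thms)
      finally show "ennreal 2 * indicator F u \<le> ennreal (K / l) * ennreal (likelihood u y)
          + ennreal (1 / K) * (ennreal (l / likelihood u y) * indicator F u)"
        by (cases "u \<in> F") simp_all
    qed
    also have "\<dots> = ennreal (K / l) * V + ennreal (1 / K) * W y"
      unfolding V_def W_def l_def by (simp add: nn_integral_add nn_integral_cmult)
    also have "\<dots> \<le> ennreal (K / l) * V + ennreal m" by (intro add_left_mono WK)
    finally have "ennreal m \<le> ennreal (K / l) * V"
      by (simp add: ennreal_add_left_cancel_le add.commute)
    then have "ennreal (l / K) * ennreal m \<le> ennreal (l / K) * (ennreal (K / l) * V)"
      by (intro mult_left_mono) auto
    also have "\<dots> = V"
      using K l by (simp add: mult.assoc[symmetric] flip: ennreal_mult')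
    finally have "ennreal (l * (1 / K) * m) \<le> V"
      using m K l by (simp flip: ennreal_mult')
    moreover have "1 / K = exp (- (2 * real n * \<epsilon>\<^sup>2))"
      by (simp add: K_def x_def exp_minus field_simps)
    ultimately show "ennreal (likelihood u0 y * exp (- (2 * real n * \<epsilon>\<^sup>2)) * measure \<mu> F)
        \<le> (\<integral>\<^sup>+u. ennreal (likelihood u y) \<partial>\<mu>)"
      by (simp add: l_def m_def V_def)
  qed
qed

text \<open>Markov's inequality with a threshold proportional to the density of the true law: that
  density cancels, and Fubini turns the integrated numerator into the probability of
  \<open>A\<close> under each \<open>Q u\<close>.\<close>

lemma posterior_numerator_bound:
  assumes A [measurable]: "A \<in> sets data_space" and B [measurable]: "B \<in> sets borel" and \<tau>: "\<tau> > 0"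
  shows "emeasure (Q u0) {y \<in> A. ennreal (\<tau> * likelihood u0 y)
        \<le> (\<integral>\<^sup>+u. ennreal (likelihood u y) * indicator B u \<partial>\<mu>)}
    \<le> ennreal (1 / \<tau>) * (\<integral>\<^sup>+u. emeasure (Q u) A * indicator B u \<partial>\<mu>)"
proof -
  interpret PS: pair_sigma_finite \<gamma> \<mu> by unfold_locales
  define N where "N y = (\<integral>\<^sup>+u. ennreal (likelihood u y) * indicator B u \<partial>\<mu>)" for y
  have [measurable]: "N \<in> borel_measurable data_space"
    unfolding N_def by measurable
  define E where "E = {y \<in> A. ennreal (\<tau> * likelihood u0 y) \<le> N y}"
  have "E = A \<inter> {y \<in> space data_space. ennreal (\<tau> * likelihood u0 y) \<le> N y}"
    by (auto simp: E_def space_PiM)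
  also have "\<dots> \<in> sets data_space"
    by (intro sets.Int A borel_measurable_le) measurable
  finally have E [measurable]: "E \<in> sets data_space" .
  have "emeasure (Q u0) E = (\<integral>\<^sup>+y. ennreal (likelihood u0 y) * indicator E y \<partial>\<gamma>)"
    by (rule emeasure_Q[OF E])
  also have "\<dots> \<le> (\<integral>\<^sup>+y. ennreal (1 / \<tau>) * (N y * indicator A y) \<partial>\<gamma>)"
  proof (intro nn_integral_mono)
    fix y
    have "ennreal (likelihood u0 y) \<le> ennreal (1 / \<tau>) * N y" if "y \<in> E"
    proof -
      have "ennreal (likelihood u0 y) = ennreal (1 / \<tau>) * ennreal (\<tau> * likelihood u0 y)"
        using \<tau> by (simp flip: ennreal_mult')
      also have "\<dots> \<le> ennreal (1 / \<tau>) * N y"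
        using that by (intro mult_left_mono) (auto simp: E_def)
      finally show ?thesis .
    qed
    then show "ennreal (likelihood u0 y) * indicator E y \<le> ennreal (1 / \<tau>) * (N y * indicator A y)"
      by (auto simp: indicator_def E_def)
  qed
  also have "\<dots> = ennreal (1 / \<tau>) * (\<integral>\<^sup>+y. N y * indicator A y \<partial>\<gamma>)"
    by (rule nn_integral_cmult) measurable
  also have "(\<integral>\<^sup>+y. N y * indicator A y \<partial>\<gamma>)
      = (\<integral>\<^sup>+y. (\<integral>\<^sup>+u. ennreal (likelihood u y) * indicator A y * indicator B u \<partial>\<mu>) \<partial>\<gamma>)"
  proof (intro nn_integral_cong)
    fix y
    note [measurable] = likelihood_parameter_measurable[of y]
    have "N y * indicator A y = (\<integral>\<^sup>+u. ennreal (likelihood u y) * indicator B u * indicator A y \<partial>\<mu>)"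
      unfolding N_def by (rule nn_integral_multc[symmetric]) measurable
    then show "N y * indicator A y
        = (\<integral>\<^sup>+u. ennreal (likelihood u y) * indicator A y * indicator B u \<partial>\<mu>)"
      by (simp only: mult.assoc mult.commute[of "indicator A y"])
  qed
  also have "\<dots> = (\<integral>\<^sup>+u. (\<integral>\<^sup>+y. ennreal (likelihood u y) * indicator A y * indicator B u \<partial>\<gamma>) \<partial>\<mu>)"
    by (rule PS.Fubini'[symmetric]) measurable
  also have "\<dots> = (\<integral>\<^sup>+u. emeasure (Q u) A * indicator B u \<partial>\<mu>)"
    unfolding emeasure_Q[OF A] by (intro nn_integral_cong nn_integral_multc) measurable
  finally show ?thesis by (simp add: E_def N_def)
qed

text \<open>The summands pay for a failing estimator, for small evidence, and for a large numerator
  on the remaining event. The set \<open>B1\<close> collects parameters about which the test says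
  nothing; only its prior mass counts.\<close>

lemma posterior_contraction_bound:
  fixes u0 :: 'a and \<epsilon> s a \<delta> :: real and k :: nat
  defines "m \<equiv> measure \<mu> {u. norm (whitened (u - u0)) \<le> \<epsilon>}"
    and "p \<equiv> sqrt 2 ^ k * exp (- a\<^sup>2 / (4 * s))"
  assumes s: "s > 0" and gain: "noise_gain \<zeta> G \<phi> k \<le> real n * s" and a: "a > 0"
    and m: "m > 0" and \<epsilon>: "\<epsilon> \<ge> 0" and \<delta>: "\<delta> > 0"
    and B [measurable]: "B \<in> sets borel" and B1 [measurable]: "B1 \<in> sets borel"
    and far: "\<And>u. u \<in> B \<Longrightarrow> u \<notin> B1 \<Longrightarrow> 2 * a \<le> norm (\<Sum>j<k. (u \<bullet> \<phi> j - u0 \<bullet> \<phi> j) *\<^sub>R \<phi> j)"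
  shows "measure (Q u0) {y \<in> space data_space. measure (posterior \<zeta> G L n \<mu> y) B > \<delta>}
    \<le> p + exp (- (real n * \<epsilon>\<^sup>2)) + exp (2 * real n * \<epsilon>\<^sup>2) / (\<delta> * m) * (measure \<mu> B1 + p)"
proof -
  define x where "x = real n * \<epsilon>\<^sup>2"
  \<comment> \<open>\<delta> times the lower bound for the evidence, both relative to
    \<open>likelihood u0 y\<close>.\<close>
  define \<tau> where "\<tau> = \<delta> * (exp (- (2 * x)) * m)"
  have \<tau>: "\<tau> > 0" using m \<delta> by (simp add: \<tau>_def)
  have p0: "p \<ge> 0" by (simp add: p_def)
  define Z where "Z u = {y. a\<^sup>2 \<le> (\<Sum>j<k. (estimator j y - u \<bullet> \<phi> j)\<^sup>2)}" for u
  have Z_sets [measurable]: "Z u \<in> sets data_space" for u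
  proof -
    have "Z u = {y \<in> space data_space. a\<^sup>2 \<le> (\<Sum>j<k. (estimator j y - u \<bullet> \<phi> j)\<^sup>2)}"
      by (simp add: Z_def space_PiM)
    also have "\<dots> \<in> sets data_space" by measurable
    finally show ?thesis .
  qed
  have Z_le: "emeasure (Q u) (Z u) \<le> ennreal p" for u
    unfolding Z_def p_def by (rule estimator_concentration[OF s gain])
  define A where "A = - Z u0"
  have A_sets [measurable]: "A \<in> sets data_space"
    using sets.compl_sets[OF Z_sets[of u0]] by (simp add: A_def space_PiM Compl_eq_Diff_UNIV)
  \<comment> \<open>An estimate closer than \<open>a\<close> to the truth cannot also be closer than
    \<open>a\<close> to a projection at distance \<open>2 * a\<close>.\<close>
  have A_sub: "A \<subseteq> Z u" if "u \<in> B" "u \<notin> B1" for u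
  proof
    fix y assume "y \<in> A"
    have sq: "(\<Sum>j<k. (estimator j y - v \<bullet> \<phi> j)\<^sup>2) = (norm (\<Sum>j<k. (estimator j y - v \<bullet> \<phi> j) *\<^sub>R \<phi> j))\<^sup>2" for v
      by (simp add: phi.norm_sum_basis)
    have "(norm (\<Sum>j<k. (estimator j y - u0 \<bullet> \<phi> j) *\<^sub>R \<phi> j))\<^sup>2 < a\<^sup>2"
      using \<open>y \<in> A\<close> by (simp add: A_def Z_def sq)
    then have near: "norm (\<Sum>j<k. (estimator j y - u0 \<bullet> \<phi> j) *\<^sub>R \<phi> j) < a"
      using a by (simp add: power_less_imp_less_base)
    have "(\<Sum>j<k. (u \<bullet> \<phi> j - u0 \<bullet> \<phi> j) *\<^sub>R \<phi> j)
        = (\<Sum>j<k. (estimator j y - u0 \<bullet> \<phi> j) *\<^sub>R \<phi> j) - (\<Sum>j<k. (estimator j y - u \<bullet> \<phi> j) *\<^sub>R \<phi> j)"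
      by (simp add: sum_subtractf[symmetric] scaleR_left_diff_distrib)
    then have "2 * a \<le> norm (\<Sum>j<k. (estimator j y - u0 \<bullet> \<phi> j) *\<^sub>R \<phi> j)
        + norm (\<Sum>j<k. (estimator j y - u \<bullet> \<phi> j) *\<^sub>R \<phi> j)"
      using far[OF that] norm_triangle_ineq4[of "\<Sum>j<k. (estimator j y - u0 \<bullet> \<phi> j) *\<^sub>R \<phi> j"
          "\<Sum>j<k. (estimator j y - u \<bullet> \<phi> j) *\<^sub>R \<phi> j"] by simp
    then have "a \<le> norm (\<Sum>j<k. (estimator j y - u \<bullet> \<phi> j) *\<^sub>R \<phi> j)" using near by linarith
    then show "y \<in> Z u" using a by (simp add: Z_def sq power_mono)
  qed
  obtain E where E [measurable]: "E \<in> sets data_space" and E_le: "emeasure (Q u0) E \<le> ennreal (exp (- x))"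
    and E_lower: "\<And>y. y \<notin> E \<Longrightarrow> ennreal (likelihood u0 y * exp (- (2 * x)) * m)
      \<le> (\<integral>\<^sup>+u. ennreal (likelihood u y) \<partial>\<mu>)"
    using evidence_lower_bound[of u0 \<epsilon>] m \<epsilon> unfolding m_def x_def by (auto simp: mult.assoc)
  define N where "N y = (\<integral>\<^sup>+u. ennreal (likelihood u y) * indicator B u \<partial>\<mu>)" for y
  define H where "H = {y \<in> A. ennreal (\<tau> * likelihood u0 y) \<le> N y}"
  have [measurable]: "N \<in> borel_measurable data_space" unfolding N_def by measurable
  have H_sets [measurable]: "H \<in> sets data_space"
  proof -
    have "H = A \<inter> {y \<in> space data_space. ennreal (\<tau> * likelihood u0 y) \<le> N y}"
      by (auto simp: H_def space_PiM)
    also have "\<dots> \<in> sets data_space" by (intro sets.Int A_sets borel_measurable_le) measurable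
    finally show ?thesis .
  qed
  have H_le: "emeasure (Q u0) H \<le> ennreal (1 / \<tau> * (measure \<mu> B1 + p))"
  proof -
    have "emeasure (Q u0) H \<le> ennreal (1 / \<tau>) * (\<integral>\<^sup>+u. emeasure (Q u) A * indicator B u \<partial>\<mu>)"
      unfolding H_def N_def by (rule posterior_numerator_bound[OF A_sets B \<tau>])
    also have "(\<integral>\<^sup>+u. emeasure (Q u) A * indicator B u \<partial>\<mu>) \<le> (\<integral>\<^sup>+u. indicator B1 u + ennreal p \<partial>\<mu>)"
    proof (intro nn_integral_mono)
      fix u
      have "emeasure (Q u) A \<le> ennreal p" if "u \<in> B" "u \<notin> B1"
        using emeasure_mono[OF A_sub[OF that], of "Q u"] Z_le[of u] by (simp add: sets_data_law)
      moreover have "emeasure (Q u) A \<le> 1" by (rule Q.emeasure_le_1)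
      moreover have "1 \<le> 1 + ennreal p" by simp
      ultimately show "emeasure (Q u) A * indicator B u \<le> indicator B1 u + ennreal p"
        by (cases "u \<in> B"; cases "u \<in> B1") (auto intro: order_trans)
    qed
    also have "\<dots> = ennreal (measure \<mu> B1 + p)"
      using p0 by (simp add: nn_integral_add prior.emeasure_eq_measure prior.emeasure_space_1 sets_prior
          measure_nonneg prior.prob_space space_prior[symmetric] flip: ennreal_plus)
    finally have "emeasure (Q u0) H \<le> ennreal (1 / \<tau>) * ennreal (measure \<mu> B1 + p)"
      by (simp add: mult_left_mono)
    then show ?thesis using \<tau> by (subst ennreal_mult') auto
  qed
  have bad: "{y \<in> space data_space. measure (posterior \<zeta> G L n \<mu> y) B > \<delta>} \<subseteq> Z u0 \<union> E \<union> H"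
  proof (safe, rule ccontr)
    fix y
    note [measurable] = likelihood_parameter_measurable[of y]
    assume y: "\<delta> < measure (posterior \<zeta> G L n \<mu> y) B" "y \<notin> H" "y \<notin> E" "y \<notin> Z u0"
    define V where "V = (\<integral>\<^sup>+u. ennreal (likelihood u y) \<partial>\<mu>)"
    have lower: "ennreal (likelihood u0 y * exp (- (2 * x)) * m) \<le> V"
      unfolding V_def by (rule E_lower[OF y(3)])
    have "0 < likelihood u0 y * exp (- (2 * x)) * m" using m likelihood_pos by simp
    then have V0: "V \<noteq> 0" using lower by (auto simp: ennreal_eq_0_iff)
    have post: "emeasure (posterior \<zeta> G L n \<mu> y) B = N y / V"
    proof -
      have "emeasure (posterior \<zeta> G L n \<mu> y) B = (\<integral>\<^sup>+u. (ennreal (likelihood u y) / V) * indicator B u \<partial>\<mu>)"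
        unfolding posterior_def likelihood_def[symmetric] V_def[symmetric]
        by (subst emeasure_density) (auto simp: sets_prior)
      also have "\<dots> = (\<integral>\<^sup>+u. ennreal (likelihood u y) * indicator B u / V \<partial>\<mu>)"
        by (intro nn_integral_cong) (auto simp: indicator_def)
      also have "\<dots> = N y / V"
        unfolding N_def by (rule nn_integral_divide) measurable
      finally show ?thesis .
    qed
    have "ennreal \<delta> \<le> N y / V"
    proof (cases "N y / V = \<top>")
      case False
      then show ?thesis using y(1) \<delta> unfolding measure_def post
        by (metis ennreal_enn2real_if ennreal_leI infinity_ennreal_def less_imp_le)
    qed simp
    then have "ennreal \<delta> * V \<le> V * (N y / V)" by (simp add: mult.commute mult_left_mono)
    \<comment> \<open>Infinite evidence would make the quotient 0 and contradict
      \<open>\<delta> > 0\<close>.\<close>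
    moreover have "V \<noteq> \<top>"
      using \<open>ennreal \<delta> \<le> N y / V\<close> \<delta> by (auto simp: ennreal_divide_top)
    ultimately have "ennreal \<delta> * V \<le> N y"
      using V0 by (simp add: ennreal_times_divide ennreal_mult_divide_eq mult.commute[of V])
    then have "ennreal \<delta> * ennreal (likelihood u0 y * exp (- (2 * x)) * m) \<le> N y"
      using lower mult_left_mono order_trans by (metis zero_le)
    then have "ennreal (\<tau> * likelihood u0 y) \<le> N y"
      using \<delta> by (simp add: \<tau>_def mult_ac flip: ennreal_mult')
    then show False using y(2,4) by (simp add: H_def A_def)
  qed
  have "ennreal (measure (Q u0) {y \<in> space data_space. measure (posterior \<zeta> G L n \<mu> y) B > \<delta>})
      \<le> ennreal (measure (Q u0) (Z u0 \<union> E \<union> H))"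
    by (rule ennreal_leI, rule Q.finite_measure_mono[OF bad]) measurable
  also have " \<dots> \<le> emeasure (Q u0) (Z u0) + emeasure (Q u0) E + emeasure (Q u0) H"
    unfolding Q.emeasure_eq_measure[symmetric]
    by (intro order_trans[OF emeasure_subadditive] add_mono order_refl) measurable
  also have "\<dots> \<le> ennreal p + ennreal (exp (- x)) + ennreal (1 / \<tau> * (measure \<mu> B1 + p))"
    by (intro add_mono Z_le E_le H_le)
  also have "\<dots> = ennreal (p + exp (- x) + 1 / \<tau> * (measure \<mu> B1 + p))"
    using p0 \<tau> by (simp flip: ennreal_plus)
  finally have "measure (Q u0) {y \<in> space data_space. measure (posterior \<zeta> G L n \<mu> y) B > \<delta>}
      \<le> p + exp (- x) + 1 / \<tau> * (measure \<mu> B1 + p)"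
    using p0 \<tau> by (subst (asm) ennreal_le_iff) auto
  moreover have "1 / \<tau> = exp (2 * real n * \<epsilon>\<^sup>2) / (\<delta> * m)"
    by (simp add: \<tau>_def x_def exp_minus field_simps)
  ultimately show ?thesis by (simp add: x_def)
qed

end

section \<open>Choice of the constants and passage to the limit\<close>

theorem lemma3p14:
  fixes G :: "'a::{real_inner, polish_space} \<Rightarrow> 'b::{real_inner, polish_space}"
    and \<zeta> :: "'b \<Rightarrow> 'b"
    and b :: "nat \<Rightarrow> 'b"
    and P :: "'o measure"
    and \<eta> :: "'o \<Rightarrow> nat \<Rightarrow> real"
    and L :: "nat \<Rightarrow> (nat \<Rightarrow> real) \<Rightarrow> 'b \<Rightarrow> real"
    and \<mu> :: "nat \<Rightarrow> 'a measure"
    and u0 :: 'a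
    and \<phi> :: "nat \<Rightarrow> 'a"
    and \<epsilon> \<xi> :: "nat \<Rightarrow> real"
    and k :: "nat \<Rightarrow> nat"
    and C C1 C2 R :: real
  assumes G: "bounded_linear G" "inj G"
    and cov: "cov_operator \<zeta>"
    and range_G: "range G \<subseteq> cm_space \<zeta>"
    and basis_b: "orthonormal_basis b"
    and noise: "gaussian_noise P \<zeta> b \<eta>"
    and pairing: "\<And>n. n \<ge> 1 \<Longrightarrow> cm_functional \<zeta> b (data_law P b \<eta> G n 0) (L n)"
    and prior: "\<And>n. n \<ge> 1 \<Longrightarrow> prob_space (\<mu> n)" "\<And>n. n \<ge> 1 \<Longrightarrow> sets (\<mu> n) = sets borel"
    and basis_\<phi>: "orthonormal_basis \<phi>"
    and S_defined: "\<And>j. \<phi> j \<in> inv_adjoint_dom G"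
    and pos: "\<And>n. n \<ge> 1 \<Longrightarrow> \<epsilon> n > 0" "\<And>n. n \<ge> 1 \<Longrightarrow> \<xi> n > 0" "\<And>n. n \<ge> 1 \<Longrightarrow> k n > 0"
      "C > 0" "C1 > 0" "C2 > 0" "R > 0"
    and cond1: "\<epsilon> \<longlonglongrightarrow> 0"
      "filterlim (\<lambda>n. real n * (\<epsilon> n)\<^sup>2) at_top sequentially"
      "\<And>n. n \<ge> 1 \<Longrightarrow>
         measure (\<mu> n) {u. cm_norm \<zeta> (G u - G u0) \<le> \<epsilon> n} \<ge> exp (- C * real n * (\<epsilon> n)\<^sup>2)"
    and cond2: "\<And>n. n \<ge> 1 \<Longrightarrow> real (k n) < R * real n * (\<epsilon> n)\<^sup>2"
      "(\<lambda>n. max (\<xi> n) (1 / real (k n))) \<longlonglongrightarrow> 0"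
      "\<And>n. n \<ge> 1 \<Longrightarrow>
         measure (\<mu> n) {u. norm (orth_proj (span (\<phi> ` {..<k n})) u - u) > C2 * \<xi> n}
           \<le> exp (- (C + 4) * real n * (\<epsilon> n)\<^sup>2)"
    and cond3: "\<And>n. n \<ge> 1 \<Longrightarrow> sqrt (noise_gain \<zeta> G \<phi> (k n)) \<le> C1 * \<xi> n / \<epsilon> n"
    and cond4: "(\<lambda>n. norm (orth_proj (span (\<phi> ` {..<k n})) u0 - u0)) \<in> O(\<xi>)"
  shows "\<exists>M>0. \<forall>\<delta>>0.
           (\<lambda>n. measure (data_law P b \<eta> G n u0)
                  {y \<in> space data_space.
                     measure (posterior \<zeta> G (L n) n (\<mu> n) y) {u. norm (u - u0) > M * \<xi> n} > \<delta>})
           \<longlonglongrightarrow> 0"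
proof -
  have gain_le: "noise_gain \<zeta> G \<phi> (k n) \<le> (C1 * \<xi> n / \<epsilon> n)\<^sup>2" if "n \<ge> 1" for n
    using cond3[OF that] by (rule sqrt_le_D)
  define x where "x n = real n * (\<epsilon> n)\<^sup>2" for n
  \<comment> \<open>Chosen so that \<open>a^2 / (4 * s) = (R + C + 4) * x n\<close>: the part
    \<open>R\<close> pays for the dimension factor, and \<open>C + 4\<close> matches the prior mass
    bound for badly approximated parameters.\<close>
  define M1 where "M1 = 2 * C1 * sqrt (R + C + 4)"
  have M1: "M1 > 0" using pos by (simp add: M1_def)
  obtain c where c: "c > 0" and bias: "\<forall>\<^sub>F n in sequentially.
      norm (norm (orth_proj (span (\<phi> ` {..<k n})) u0 - u0)) \<le> c * norm (\<xi> n)"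
    using landau_o.bigE[OF cond4] by blast
  \<comment> \<open>Approximation error of \<open>u\<close>, approximation error of
    \<open>u0\<close>, and the separation \<open>2 * a\<close> that the test requires.\<close>
  define M where "M = C2 + c + 2 * M1"
  have M: "M > 0" using M1 c pos by (simp add: M_def)
  have bound: "measure (data_law P b \<eta> G n u0) {y \<in> space data_space.
      measure (posterior \<zeta> G (L n) n (\<mu> n) y) {u. norm (u - u0) > M * \<xi> n} > \<delta>}
      \<le> (2 + 2 / \<delta>) * exp (- x n)"
    if n: "n \<ge> 1" and \<delta>: "\<delta> > 0"
      and bias_n: "norm (norm (orth_proj (span (\<phi> ` {..<k n})) u0 - u0)) \<le> c * norm (\<xi> n)" for n \<delta>
  proof -
    interpret prior_model \<zeta> b G P \<eta> n "L n" \<phi> "\<mu> n"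
      using cov basis_b G range_G noise n pairing basis_\<phi> S_defined prior
      by (intro prior_model.intro inverse_problem.intro gaussian_model.intro covariance.intro onb.intro
          gaussian_model_axioms.intro inverse_problem_axioms.intro prior_model_axioms.intro) auto
    have \<epsilon>: "\<epsilon> n > 0" and \<xi>: "\<xi> n > 0" using pos n by auto
    have x0: "x n > 0" using n \<epsilon> by (simp add: x_def)
    define a where "a = M1 * \<xi> n"
    \<comment> \<open>The bound that the gain condition gives for the covariance
      \<open>noise_gain \<zeta> G \<phi> (k n) / n\<close>.\<close>
    define s where "s = (C1 * \<xi> n)\<^sup>2 / x n"
    define B where "B = {u. norm (u - u0) > M * \<xi> n}"
    define B1 where "B1 = {u. norm (orth_proj (span (\<phi> ` {..<k n})) u - u) > C2 * \<xi> n}"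
    define m where "m = measure (\<mu> n) {u. norm (whitened (u - u0)) \<le> \<epsilon> n}"
    define p where "p = sqrt 2 ^ k n * exp (- a\<^sup>2 / (4 * s))"
    have m: "m \<ge> exp (- (C * x n))"
    proof -
      have "{u. cm_norm \<zeta> (G u - G u0) \<le> \<epsilon> n} = {u. norm (whitened (u - u0)) \<le> \<epsilon> n}"
        by (simp add: cm_norm_G flip: G.diff)
      then show ?thesis using cond1(3)[OF n] by (simp add: m_def x_def mult.assoc)
    qed
    have m0: "m > 0" using m by (rule less_le_trans[rotated]) simp
    have B1_le: "measure (\<mu> n) B1 \<le> exp (- ((C + 4) * x n))"
      using cond2(3)[OF n] by (simp add: B1_def x_def mult.assoc flip: mult_minus_left)
    have s0: "s > 0" using pos \<xi> x0 by (simp add: s_def)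
    have p_le: "p \<le> exp (- ((C + 4) * x n))"
    proof -
      have "a\<^sup>2 / (4 * s) = (R + C + 4) * x n"
        using pos \<xi> x0 by (simp add: a_def s_def M1_def power_mult_distrib field_simps)
      moreover have "sqrt 2 ^ k n \<le> exp (R * x n)"
      proof -
        have "sqrt 2 \<le> exp 1"
          using exp_ge_add_one_self[of 1] real_le_lsqrt[of 2 2] by simp
        then have "sqrt 2 ^ k n \<le> exp 1 ^ k n" by (intro power_mono) auto
        also have "\<dots> = exp (real (k n))" by (simp flip: exp_of_nat_mult)
        also have "\<dots> \<le> exp (R * x n)" using cond2(1)[OF n] by (simp add: x_def mult.assoc)
        finally show ?thesis .
      qed
      ultimately have "p \<le> exp (R * x n) * exp (- ((R + C + 4) * x n))"
        by (simp add: p_def)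
      then show ?thesis unfolding exp_add[symmetric] by (simp add: algebra_simps)
    qed
    have far: "2 * a \<le> norm (\<Sum>j<k n. (u \<bullet> \<phi> j - u0 \<bullet> \<phi> j) *\<^sub>R \<phi> j)" if "u \<in> B" "u \<notin> B1" for u
    proof -
      let ?P = "\<lambda>u. \<Sum>j<k n. (u \<bullet> \<phi> j) *\<^sub>R \<phi> j"
      have "M * \<xi> n < norm (u - u0)" using that by (simp add: B_def)
      also have "u - u0 = (?P u - ?P u0) - ((?P u - u) - (?P u0 - u0))" by simp
      also have "norm \<dots> \<le> norm (?P u - ?P u0) + (norm (?P u - u) + norm (?P u0 - u0))"
        by (intro order_trans[OF norm_triangle_ineq4] add_left_mono norm_triangle_ineq4)
      also have "norm (?P u - u) \<le> C2 * \<xi> n"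
        using that by (simp add: B1_def phi.orth_proj_span)
      also have "norm (?P u0 - u0) \<le> c * \<xi> n"
        using bias_n \<xi> by (simp add: phi.orth_proj_span)
      finally have "2 * a \<le> norm (?P u - ?P u0)"
        by (simp add: M_def a_def algebra_simps)
      then show ?thesis by (simp add: sum_subtractf scaleR_left_diff_distrib)
    qed
    have "measure (Q u0) {y \<in> space data_space. measure (posterior \<zeta> G (L n) n (\<mu> n) y) B > \<delta>}
        \<le> p + exp (- (real n * (\<epsilon> n)\<^sup>2)) + exp (2 * real n * (\<epsilon> n)\<^sup>2) / (\<delta> * m) * (measure (\<mu> n) B1 + p)"
      unfolding p_def m_def
    proof (rule posterior_contraction_bound[OF s0])
      have "n * s = (C1 * \<xi> n / \<epsilon> n)\<^sup>2"
        using n \<epsilon> by (simp add: s_def x_def power_divide)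
      then show "noise_gain \<zeta> G \<phi> (k n) \<le> n * s" using gain_le[OF n] by simp
      show "a > 0" using M1 \<xi> by (simp add: a_def)
      show "0 < measure (\<mu> n) {u. norm (whitened (u - u0)) \<le> \<epsilon> n}" using m0 by (simp add: m_def)
      show "B \<in> sets borel" "B1 \<in> sets borel"
        unfolding B_def B1_def phi.orth_proj_span
        by (auto intro!: borel_open open_Collect_less continuous_intros)
    qed (use \<epsilon> \<delta> far in auto)
    also have "\<dots> \<le> exp (- x n) + exp (- x n) + (2 / \<delta>) * exp (- x n)"
    proof (intro add_mono)
      show "p \<le> exp (- x n)"
      proof (rule order_trans[OF p_le])
        have "1 * x n \<le> (C + 4) * x n" using pos x0 by (intro mult_right_mono) auto
        then show "exp (- ((C + 4) * x n)) \<le> exp (- x n)" by simp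
      qed
      \<comment> \<open>Exponent balance in units of \<open>x n\<close>: 2 from the evidence,
        \<open>C\<close> from the small ball, \<open>- (C + 4)\<close> from the numerator; -2
        remains.\<close>
      have "exp (2 * real n * (\<epsilon> n)\<^sup>2) / (\<delta> * m) * (measure (\<mu> n) B1 + p)
          \<le> exp (2 * x n) / (\<delta> * exp (- (C * x n))) * (2 * exp (- ((C + 4) * x n)))"
      proof (intro mult_mono frac_le)
        show "measure (\<mu> n) B1 + p \<le> 2 * exp (- ((C + 4) * x n))" using B1_le p_le by simp
        show "exp (- (C * x n)) \<le> m" by (rule m)
      qed (use \<delta> in \<open>auto simp: x_def p_def mult.assoc\<close>)
      also have "\<dots> = (2 / \<delta>) * exp (- (2 * x n))"
        using \<delta> by (simp add: field_simps exp_minus flip: exp_add)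
      also have "\<dots> \<le> (2 / \<delta>) * exp (- x n)"
        using \<delta> x0 by (intro mult_left_mono) auto
      finally show "exp (2 * real n * (\<epsilon> n)\<^sup>2) / (\<delta> * m) * (measure (\<mu> n) B1 + p)
          \<le> (2 / \<delta>) * exp (- x n)" .
    qed (simp add: x_def)
    finally show ?thesis by (simp add: B_def algebra_simps)
  qed
  show ?thesis
  proof (intro exI[of _ M] conjI M allI impI)
    fix \<delta> :: real assume \<delta>: "\<delta> > 0"
    have "filterlim x at_top sequentially" using cond1(2) by (simp add: x_def[abs_def])
    then have "(\<lambda>n. exp (- x n)) \<longlonglongrightarrow> 0"
      by (intro filterlim_compose[OF exp_at_bot]) (simp add: filterlim_uminus_at_bot)
    then have lim: "(\<lambda>n. (2 + 2 / \<delta>) * exp (- x n)) \<longlonglongrightarrow> 0"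
      using tendsto_mult_right_zero by blast
    show "(\<lambda>n. measure (data_law P b \<eta> G n u0) {y \<in> space data_space.
        measure (posterior \<zeta> G (L n) n (\<mu> n) y) {u. norm (u - u0) > M * \<xi> n} > \<delta>}) \<longlonglongrightarrow> 0"
    proof (rule tendsto_sandwich[OF _ _ tendsto_const lim])
      show "\<forall>\<^sub>F n in sequentially. measure (data_law P b \<eta> G n u0) {y \<in> space data_space.
          measure (posterior \<zeta> G (L n) n (\<mu> n) y) {u. norm (u - u0) > M * \<xi> n} > \<delta>}
          \<le> (2 + 2 / \<delta>) * exp (- x n)"
        using bias eventually_ge_at_top[of 1] by eventually_elim (rule bound[OF _ \<delta>])
    qed simp
  qed
qed

end
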